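(* Let $d\ge 1$, $w_1,\dots,w_d\in\mathcal H$, $\bm w=(w_1,\dots,w_d)$, and let $q\in\{1,\dots,d\}$. Then $$\begin{aligned} F.P.[\zeta_{\rm Bh}(\alpha|\bm w)]_{\alpha=q}={}&\lim_{M\to\infty}\Biggl[\frac{(-1)^q}{(q-1)!}\sum_{m=0}^{d-q}\frac{{}_dS_m^{(d)}(0)}{m!\,(d-q-m)!}F\bigl[x^{d-q-m}\log x\bigr]_{x=\bm w}M^{d-q-m}\\ &\qquad+\frac{{}_dS_{d-q}^{(d)}(0)\,(-1)^{d+q+1}}{(q-1)!\,(d-q)!}\log M+\sum_{\bm n\in\mathcal C_{M-1}\setminus\{\bm 0\}}(\bm n\cdot\bm w)^{-q}\Biggr]\\ &+\frac{{}_dS_{d-q}^{(d)}(0)\,(-1)^{d+q+1}}{(q-1)!\,(d-q)!}H_{q-1}, \end{aligned}$$ where the limit is over positive integers $M$ and $\log M$ is the real logarithm.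
   Context: $\mathcal H=\{z\in\mathbb C:\theta-\frac{\pi}{2}<\arg z<\theta+\frac{\pi}{2}\}$ is a fixed open half-plane ($\theta$ a fixed real angle), and $\log$ on $\mathcal H$ is a fixed holomorphic branch of the logarithm; $z^s=\exp(s\log z)$ for $z\in\mathcal H$. $\mathbb N_0=\{0,1,2,\dots\}$, $\bm n\cdot\bm w=\sum_{i=1}^d n_iw_i$, and $\mathcal C_M=\{0,1,\dots,M\}^d$. The homogeneous Barnes zeta function is $\zeta_{\rm Bh}(\alpha|\bm w)=\sum_{\bm n\in\mathbb N_0^d\setminus\{\bm 0\}}(\bm n\cdot\bm w)^{-\alpha}$ for $\Re(\alpha)>d$; it extends meromorphically in $\alpha$ to $\mathbb C$, with at most simple poles, located at $\alpha=1,\dots,d$. $F.P.[f(\alpha)]_{\alpha=q}$ denotes the constant term of the Laurent expansion of $f$ at $\alpha=q$. For $\bm v\in\mathbb C^d$ and a function $g$ of $x$, $F[g(x)]_{x=\bm v}=\sum_{\emptyset\ne S\subseteq\{1,\dots,d\}}(-1)^{d-|S|}g\bigl(\sum_{i\in S}v_i\bigr)$. Harmonic numbers: $H_k=\sum_{i=1}^k 1/i$, $H_0=0$. The higher order Bernoulli polynomials $B_n(a|\bm w)$ are defined by $z^d{\rm e}^{az}\prod_{i=1}^d\frac{w_i}{{\rm e}^{w_iz}-1}=\sum_{n\ge0}B_n(a|\bm w)\frac{z^n}{n!}$ for $|z|<2\pi/\max_i|w_i|$. The Bernoullian functions ${}_dS_n(a)$ ($n\ge0$; dependence on $\bm w$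 suppressed) are the polynomials in $a$ with ${}_dS_n(0)=0$ and ${}_dS_n'(a)=\frac{n!}{(n+d-1)!\,\prod_{i=1}^dw_i}B_{n+d-1}(a|\bm w)$; ${}_dS_m^{(d)}(0)$ is the $d$-th derivative in $a$ at $a=0$ (equivalently ${}_dS_m^{(d)}(0)=B_m(0|\bm w)/\prod_{i=1}^dw_i$). *)

theory Defs
  imports "HOL-Complex_Analysis.Complex_Analysis"
begin

definition half_plane :: "real \<Rightarrow> complex set" where
  "half_plane \<theta> = {of_real r * cis \<phi> | r \<phi>. 0 < r \<and> \<theta> - pi / 2 < \<phi> \<and> \<phi> < \<theta> + pi / 2}"

definition log_branch_on :: "(complex \<Rightarrow> complex) \<Rightarrow> complex set \<Rightarrow> bool" where
  "log_branch_on L H \<longleftrightarrow> L holomorphic_on H \<and> (\<forall>z\<in>H. exp (L z) = z)"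

definition branch_power :: "(complex \<Rightarrow> complex) \<Rightarrow> complex \<Rightarrow> complex \<Rightarrow> complex" where
  "branch_power L z s = exp (s * L z)"

text \<open>A \<open>d\<close>-tuple is a function on \<open>{1..d}\<close>; tuples of naturals are made canonical by
  extensionality (value \<open>undefined\<close> outside \<open>{1..d}\<close>), so that each is counted once.\<close>

definition lattice :: "nat \<Rightarrow> (nat \<Rightarrow> nat) set" where
  "lattice d = {1..d} \<rightarrow>\<^sub>E UNIV"

definition cube :: "nat \<Rightarrow> nat \<Rightarrow> (nat \<Rightarrow> nat) set" where
  "cube d M = {1..d} \<rightarrow>\<^sub>E {0..M}"

definition zero_tuple :: "nat \<Rightarrow> nat \<Rightarrow> nat" where
  "zero_tuple d = (\<lambda>i\<in>{1..d}. 0)"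

definition tuple_dot :: "nat \<Rightarrow> (nat \<Rightarrow> nat) \<Rightarrow> (nat \<Rightarrow> complex) \<Rightarrow> complex" where
  "tuple_dot d n w = (\<Sum>i=1..d. of_nat (n i) * w i)"

definition barnes_series :: "(complex \<Rightarrow> complex) \<Rightarrow> nat \<Rightarrow> (nat \<Rightarrow> complex) \<Rightarrow> complex \<Rightarrow> complex" where
  "barnes_series L d w \<alpha> =
     (\<Sum>\<^sub>\<infinity>n\<in>lattice d - {zero_tuple d}. branch_power L (tuple_dot d n w) (- \<alpha>))"

text \<open>The meromorphic continuation of the series to the whole plane. Requiring it to be
  \<^emph>\<open>nicely\<close> meromorphic (removable singularities filled in, value \<open>0\<close> at poles) pins down the
  values everywhere; see \<open>barnes_continuation_unique\<close>.\<close>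

definition barnes_zeta :: "(complex \<Rightarrow> complex) \<Rightarrow> nat \<Rightarrow> (nat \<Rightarrow> complex) \<Rightarrow> complex \<Rightarrow> complex" where
  "barnes_zeta L d w =
     (THE f. f nicely_meromorphic_on UNIV \<and> (\<forall>\<alpha>. Re \<alpha> > real d \<longrightarrow> f \<alpha> = barnes_series L d w \<alpha>))"

lemma barnes_continuation_unique:
  assumes "f nicely_meromorphic_on UNIV" "\<And>\<alpha>. Re \<alpha> > real d \<Longrightarrow> f \<alpha> = barnes_series L d w \<alpha>"
    and "g nicely_meromorphic_on UNIV" "\<And>\<alpha>. Re \<alpha> > real d \<Longrightarrow> g \<alpha> = barnes_series L d w \<alpha>"
  shows "f = g"
proof -
  let ?h = "\<lambda>z. f z - g z" and ?z = "of_real (real d + 1) :: complex"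
  have fm: "f meromorphic_on UNIV" and gm: "g meromorphic_on UNIV"
    using assms(1,3) by (auto simp: nicely_meromorphic_on_def)
  have hm: "?h meromorphic_on UNIV"
    by (intro meromorphic_intros fm gm)
  have "eventually (\<lambda>z. z \<in> {z. Re z > real d}) (at ?z)"
    by (intro eventually_at_in_open') (auto simp: open_halfspace_Re_gt)
  hence "eventually (\<lambda>z. remove_sings ?h z = 0) (at ?z)"
  proof -
    assume "eventually (\<lambda>z. z \<in> {z. Re z > real d}) (at ?z)"
    hence "eventually (\<lambda>z. ?h z = 0) (at ?z)"
      by eventually_elim (simp add: assms)
    moreover have "eventually (\<lambda>z. remove_sings ?h z = ?h z) (at ?z)"
      by (intro eventually_remove_sings_eq_at meromorphic_on_isolated_singularity
          meromorphic_on_subset[OF hm]) auto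
    ultimately show ?thesis by eventually_elim simp
  qed
  hence "frequently (\<lambda>z. remove_sings ?h z = 0) (at ?z)"
    by (rule eventually_frequently[rotated]) simp
  hence zero: "remove_sings ?h z = 0" for z
    by (rule frequently_eq_meromorphic_imp_constant[OF _ remove_sings_nicely_meromorphic[OF hm]]) auto
  have ev: "eventually (\<lambda>z. f z = g z) (at x)" for x
  proof -
    have "eventually (\<lambda>z. remove_sings ?h z = ?h z) (at x)"
      by (intro eventually_remove_sings_eq_at meromorphic_on_isolated_singularity
          meromorphic_on_subset[OF hm]) auto
    thus ?thesis
      by eventually_elim (simp add: zero)
  qed
  show "f = g"
  proof
    fix x
    have pole: "is_pole f x \<longleftrightarrow> is_pole g x"
      by (rule is_pole_cong[OF ev]) simp
    have lim: "(f \<midarrow>x\<rightarrow> c) \<longleftrightarrow> (g \<midarrow>x\<rightarrow> c)" for c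
      by (rule tendsto_cong[OF ev])
    show "f x = g x"
    proof (cases "is_pole f x")
      case True
      thus ?thesis
        using assms(1,3) pole is_pole_def not_tendsto_and_filterlim_at_infinity[of "at x"]
        unfolding nicely_meromorphic_on_def by (metis UNIV_I trivial_limit_at)
    next
      case False
      hence "f \<midarrow>x\<rightarrow> f x" "f \<midarrow>x\<rightarrow> g x"
        using assms(1,3) pole lim unfolding nicely_meromorphic_on_def by auto
      thus ?thesis by (rule LIM_unique)
    qed
  qed
qed

definition finite_part :: "(complex \<Rightarrow> complex) \<Rightarrow> complex \<Rightarrow> complex" where
  "finite_part f q = fls_nth (laurent_expansion f q) 0"

definition subset_sum_op :: "nat \<Rightarrow> (complex \<Rightarrow> complex) \<Rightarrow> (nat \<Rightarrow> complex) \<Rightarrow> complex" where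
  "subset_sum_op d g v = (\<Sum>S | S \<noteq> {} \<and> S \<subseteq> {1..d}. (-1) ^ (d - card S) * g (\<Sum>i\<in>S. v i))"

text \<open>The generating function is taken as a formal power series in \<open>z\<close>. Each quotient
  \<open>w\<^sub>i z / (e\<^bsup>w\<^sub>i z\<^esup> - 1)\<close> is a genuine power series when \<open>w\<^sub>i \<noteq> 0\<close>; see
  \<open>higher_bernoulli_sums\<close> for the analytic identity.\<close>

definition higher_bernoulli_gf :: "nat \<Rightarrow> (nat \<Rightarrow> complex) \<Rightarrow> complex \<Rightarrow> complex fps" where
  "higher_bernoulli_gf d w a =
     fps_exp a * (\<Prod>i=1..d. (fps_const (w i) * fps_X) / (fps_exp (w i) - 1))"

definition higher_bernoulli :: "nat \<Rightarrow> (nat \<Rightarrow> complex) \<Rightarrow> nat \<Rightarrow> complex \<Rightarrow> complex" where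
  "higher_bernoulli d w n a = fact n * fps_nth (higher_bernoulli_gf d w a) n"

definition bernoullian :: "nat \<Rightarrow> (nat \<Rightarrow> complex) \<Rightarrow> nat \<Rightarrow> complex poly" where
  "bernoullian d w n =
     (THE p. poly p 0 = 0 \<and>
        (\<forall>a. poly (pderiv p) a =
           fact n / (fact (n + d - 1) * (\<Prod>i=1..d. w i)) * higher_bernoulli d w (n + d - 1) a))"

definition bernoullian_deriv_0 :: "nat \<Rightarrow> (nat \<Rightarrow> complex) \<Rightarrow> nat \<Rightarrow> complex" where
  "bernoullian_deriv_0 d w m = poly ((pderiv ^^ d) (bernoullian d w m)) 0"

lemma higher_bernoulli_sums:
  assumes "\<And>i. i \<in> {1..d} \<Longrightarrow> w i \<noteq> 0"
  shows "eventually (\<lambda>z. (\<lambda>n. higher_bernoulli d w n a * z ^ n / fact n) sums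
           (z ^ d * exp (a * z) * (\<Prod>i=1..d. w i / (exp (w i * z) - 1)))) (at 0)"
proof -
  define h where "h = (\<lambda>c z::complex. if z = 0 then 1 else c * z / (exp (c * z) - 1))"
  have h: "h c has_fps_expansion (fps_const c * fps_X) / (fps_exp c - 1)" if c: "c \<noteq> 0" for c
  proof -
    have 1: "subdegree (fps_const c * fps_X) = 1"
      by (rule subdegreeI) (use c in auto)
    have 2: "subdegree (fps_exp c - 1) = 1"
      by (rule subdegreeI) (use c in auto)
    show ?thesis unfolding h_def
      by (rule has_fps_expansion_divide)
         (use c 1 2 in \<open>auto intro!: fps_expansion_intros simp del: One_nat_def\<close>)
  qed
  have "(\<lambda>z. exp (a * z) * (\<Prod>i=1..d. h (w i) z)) has_fps_expansion higher_bernoulli_gf d w a"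
    unfolding higher_bernoulli_gf_def
    by (intro has_fps_expansion_mult has_fps_expansion_prod has_fps_expansion_exp h assms)
  hence R: "fps_conv_radius (higher_bernoulli_gf d w a) > 0"
    and E: "eventually (\<lambda>z. eval_fps (higher_bernoulli_gf d w a) z =
              exp (a * z) * (\<Prod>i=1..d. h (w i) z)) (nhds 0)"
    by (auto simp: has_fps_expansion_def)
  have "eventually (\<lambda>z. z \<in> eball 0 (fps_conv_radius (higher_bernoulli_gf d w a))) (nhds 0)"
    by (rule eventually_nhds_in_open) (use R in \<open>auto simp: in_eball_iff zero_ereal_def\<close>)
  hence "eventually (\<lambda>z. z \<in> eball 0 (fps_conv_radius (higher_bernoulli_gf d w a))) (at 0)"
    "eventually (\<lambda>z. eval_fps (higher_bernoulli_gf d w a) z =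
              exp (a * z) * (\<Prod>i=1..d. h (w i) z)) (at 0)"
    using E by (auto simp: eventually_nhds_conv_at)
  moreover have "eventually (\<lambda>z. z \<noteq> (0::complex)) (at 0)"
    by (simp add: eventually_at_filter)
  ultimately show ?thesis
  proof eventually_elim
    case (elim z)
    have "(\<lambda>n. fps_nth (higher_bernoulli_gf d w a) n * z ^ n) sums
            eval_fps (higher_bernoulli_gf d w a) z"
      by (rule sums_eval_fps) (use elim in \<open>auto simp: in_eball_iff\<close>)
    moreover have "(\<Prod>i=1..d. h (w i) z) = z ^ d * (\<Prod>i=1..d. w i / (exp (w i * z) - 1))"
    proof -
      have "(\<Prod>i=1..d. h (w i) z) = (\<Prod>i=1..d. z * (w i / (exp (w i * z) - 1)))"
        using elim by (simp add: h_def mult.commute)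
      also have "\<dots> = z ^ d * (\<Prod>i=1..d. w i / (exp (w i * z) - 1))"
        by (subst prod.distrib) simp
      finally show ?thesis .
    qed
    ultimately show ?case
      using elim by (simp add: higher_bernoulli_def mult_ac)
  qed
qed

lemma bernoullian_works:
  shows poly_bernoullian_0: "poly (bernoullian d w n) 0 = 0"
    and poly_pderiv_bernoullian: "poly (pderiv (bernoullian d w n)) a =
      fact n / (fact (n + d - 1) * (\<Prod>i=1..d. w i)) * higher_bernoulli d w (n + d - 1) a"
    and bernoullian_deriv_0_eq: "d \<ge> 1 \<Longrightarrow>
      bernoullian_deriv_0 d w n = higher_bernoulli d w n 0 / (\<Prod>i=1..d. w i)"
proof -
  define N where "N = n + d - 1"
  define C where "C = fact n / (fact N * (\<Prod>i=1..d. w i))"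
  define P where "P = (\<Prod>i=1..d. (fps_const (w i) * fps_X) / (fps_exp (w i) - 1))"
  define r where "r = (\<Sum>i=0..N. monom (C * fact N * fps_nth P (N - i) / fact i) i)"
  define p where "p = pCons 0 (\<Sum>i=0..N. monom (coeff r i / of_nat (Suc i)) i)"
  have r: "poly r a = C * higher_bernoulli d w N a" for a
    by (simp add: r_def higher_bernoulli_def higher_bernoulli_gf_def P_def fps_mult_nth
        poly_sum poly_monom sum_distrib_left mult_ac)
  have cr: "coeff r i = (if i \<le> N then C * fact N * fps_nth P (N - i) / fact i else 0)" for i
    by (simp add: r_def coeff_sum)
  have pd: "pderiv p = r"
    by (rule poly_eqI) (auto simp: p_def coeff_pderiv coeff_sum cr simp del: of_nat_Suc)
  have p0: "poly p 0 = 0"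
    by (simp add: p_def)
  have p_eq: "bernoullian d w n = p"
    unfolding bernoullian_def N_def[symmetric] C_def[symmetric]
  proof (rule the_equality)
    show "poly p 0 = 0 \<and> (\<forall>a. poly (pderiv p) a = C * higher_bernoulli d w N a)"
      using p0 pd r by simp
  next
    fix p' assume p': "poly p' 0 = 0 \<and> (\<forall>a. poly (pderiv p') a = C * higher_bernoulli d w N a)"
    hence "poly (pderiv p') = poly r" by (simp add: r fun_eq_iff)
    hence "pderiv (p' - p) = 0" by (simp add: pderiv_diff pd poly_eq_poly_eq_iff)
    hence "degree (p' - p) = 0" by (simp add: pderiv_eq_0_iff)
    then obtain c where c: "p' - p = [:c:]" by (meson degree_eq_zeroE)
    hence "poly (p' - p) 0 = c" by simp
    hence "c = 0" using p0 p' by simp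
    thus "p' = p" using c by simp
  qed
  show "poly (bernoullian d w n) 0 = 0"
    "poly (pderiv (bernoullian d w n)) a =
     fact n / (fact (n + d - 1) * (\<Prod>i=1..d. w i)) * higher_bernoulli d w (n + d - 1) a"
    using p0 pd r by (simp_all add: p_eq C_def N_def)
  show "bernoullian_deriv_0 d w n = higher_bernoulli d w n 0 / (\<Prod>i=1..d. w i)" if "d \<ge> 1"
  proof -
    from \<open>d \<ge> 1\<close> obtain k where k: "d = Suc k" by (cases d) auto
    have "bernoullian_deriv_0 d w n = poly ((pderiv ^^ k) r) 0"
      unfolding bernoullian_deriv_0_def p_eq by (simp add: k funpow_Suc_right pd del: funpow.simps)
    also have "\<dots> = fact k * coeff r k"
      by (simp add: poly_0_coeff_0 coeff_higher_pderiv pochhammer_fact)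
    also have "\<dots> = C * fact N * fps_nth P n"
      using k by (simp add: cr N_def)
    also have "\<dots> = higher_bernoulli d w n 0 / (\<Prod>i=1..d. w i)"
      by (simp add: C_def higher_bernoulli_def higher_bernoulli_gf_def P_def)
    finally show ?thesis .
  qed
qed

end

theory Submission
  imports Defs
begin

text \<open>Put \<open>s = \<alpha> - d\<close> and \<open>P(\<alpha>) = (\<alpha> - 1)\<cdots>(\<alpha> - d)\<close>, so that \<open>P(\<alpha>) x\<^sup>-\<^sup>\<alpha>\<close> is \<open>(-D)\<^sup>d x\<^sup>-\<^sup>s\<close>.
  Let \<open>b\<^sub>m\<close> be the coefficients of the power series \<open>\<Prod>\<^sub>i z / (exp(w\<^sub>i z) - 1)\<close>. Since the shift by \<open>w\<^sub>i\<close>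
  is \<open>exp(w\<^sub>i D)\<close>, the function \<open>E\<^sub>N = \<Sum>\<^sub>m\<^sub>\<le>\<^sub>N b\<^sub>m D\<^sup>m x\<^sup>-\<^sup>s\<close> solves the difference equation
  \<open>\<Prod>\<^sub>i (1 - exp(w\<^sub>i D)) E = P(\<alpha>) x\<^sup>-\<^sup>\<alpha>\<close> up to an error of order \<open>\<bar>x\<bar>\<close> to the power \<open>- Re \<alpha> - N - 1\<close>.
  Summed over a cube of lattice points, the left-hand side telescopes to the values of \<open>E\<^sub>N\<close> at the
  vertices \<open>M w\<^sub>S\<close>, and the errors form a series that converges locally uniformly for
  \<open>Re \<alpha> > d - N - 1\<close>. This continues \<open>P \<zeta>\<close> to an entire function. For \<open>N = d - q\<close> it exhibits
  \<open>P \<zeta>\<close> near \<open>q\<close> as the locally uniform limit of explicit functions; the finite part at \<open>q\<close> is the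
  derivative at \<open>q\<close> of \<open>P \<zeta> / \<Prod>\<^sub>j\<^sub>\<noteq>\<^sub>q (\<alpha> - j)\<close>, hence the limit of the corresponding derivatives.\<close>

subsection \<open>Alternating sums over subsets\<close>

lemma sum_Pow_insert:
  assumes "finite I" "i \<notin> I"
  shows "(\<Sum>S\<in>Pow (insert i I). f S) = (\<Sum>S\<in>Pow I. f S) + (\<Sum>S\<in>Pow I. f (insert i S))"
proof -
  have "inj_on (insert i) (Pow I)"
    using assms by (intro inj_onI) (metis PowD insert_ident subsetD)
  moreover have "Pow I \<inter> insert i ` Pow I = {}"
    using assms by auto
  ultimately show ?thesis
    using assms by (simp add: Pow_insert sum.union_disjoint sum.reindex)
qed

text \<open>This is the operator \<open>prod_i (1 - exp(v_i D))\<close> applied to \<open>g\<close>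
  and evaluated at \<open>0\<close>. Unlike \<open>subset_sum_op\<close> it keeps the empty set,
  which makes it factor over the indices. The codomain is a general ring so that
  \<open>fps_exp\<close> is an admissible \<open>g\<close>.\<close>

definition alternating_sum :: "'i set \<Rightarrow> ('i \<Rightarrow> complex) \<Rightarrow> (complex \<Rightarrow> 'b::comm_ring_1) \<Rightarrow> 'b" where
  "alternating_sum I v g = (\<Sum>S\<in>Pow I. (-1) ^ card S * g (sum v S))"

lemma alternating_sum_insert:
  assumes "finite I" "i \<notin> I"
  shows "alternating_sum (insert i I) v g =
           alternating_sum I v g - alternating_sum I v (\<lambda>x. g (v i + x))"
proof -
  have "(\<Sum>S\<in>Pow I. (-1) ^ card (insert i S) * g (sum v (insert i S))) =
          (\<Sum>S\<in>Pow I. - ((-1) ^ card S * g (v i + sum v S)))"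
  proof (intro sum.cong refl)
    fix S assume "S \<in> Pow I"
    hence "finite S" "i \<notin> S"
      using assms finite_subset by auto
    thus "(-1) ^ card (insert i S) * g (sum v (insert i S)) = - ((-1) ^ card S * g (v i + sum v S))"
      by simp
  qed
  thus ?thesis
    unfolding alternating_sum_def sum_Pow_insert[OF assms] by (simp add: sum_negf)
qed

lemma sum_PiE_insert:
  assumes "i \<notin> I"
  shows "(\<Sum>n\<in>PiE (insert i I) B. f n) = (\<Sum>k\<in>B i. \<Sum>n\<in>PiE I B. f (n(i := k)))"
proof -
  have "(\<Sum>n\<in>PiE (insert i I) B. f n) = (\<Sum>(k, n)\<in>B i \<times> PiE I B. f (n(i := k)))"
    unfolding PiE_insert_eq using assms
    by (subst sum.reindex[OF inj_combinator]) (auto simp: case_prod_unfold)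
  thus ?thesis
    by (simp add: sum.cartesian_product)
qed

text \<open>In the direction of one index the alternating sum is a difference between consecutive
  lattice points, so its sum over \<open>k < M\<close> telescopes. The induction treats one index at
  a time; \<open>x\<close> stays arbitrary because it absorbs the shifts.\<close>

lemma alternating_sum_telescope:
  fixes g :: "complex \<Rightarrow> complex"
  assumes "finite I"
  shows "(\<Sum>n\<in>PiE I (\<lambda>_. {..<M}). alternating_sum I v (\<lambda>y. g (x + (\<Sum>i\<in>I. of_nat (n i) * v i) + y))) =
           alternating_sum I (\<lambda>i. of_nat M * v i) (\<lambda>y. g (x + y))"
  using assms
proof (induction I arbitrary: x rule: finite_induct)
  case empty
  show ?case by (simp add: alternating_sum_def)
next
  case (insert i I)
  let ?T = "\<lambda>x. \<Sum>n\<in>PiE I (\<lambda>_. {..<M}). alternating_sum I v (\<lambda>y. g (x + (\<Sum>i\<in>I. of_nat (n i) * v i) + y))"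
  have s: "(\<Sum>j\<in>insert i I. of_nat ((n(i := k)) j) * v j) = of_nat k * v i + (\<Sum>j\<in>I. of_nat (n j) * v j)"
    for n k
    using insert by (subst sum.insert) (auto intro!: sum.cong)
  have "(\<Sum>n\<in>PiE (insert i I) (\<lambda>_. {..<M}).
           alternating_sum (insert i I) v (\<lambda>y. g (x + (\<Sum>j\<in>insert i I. of_nat (n j) * v j) + y))) =
        (\<Sum>k<M. ?T (x + of_nat k * v i) - ?T (x + of_nat (Suc k) * v i))"
    unfolding sum_PiE_insert[OF insert(2)] s alternating_sum_insert[OF insert(1,2)] sum_subtractf
    by (simp add: algebra_simps)
  also have "\<dots> = ?T x - ?T (x + of_nat M * v i)"
    by (subst sum_lessThan_telescope') simp
  also have "\<dots> = alternating_sum (insert i I) (\<lambda>i. of_nat M * v i) (\<lambda>y. g (x + y))"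
    unfolding insert.IH alternating_sum_insert[OF insert(1,2)] by (simp add: add.assoc)
  finally show ?case .
qed

lemma alternating_sum_fps_exp:
  assumes "finite I"
  shows "alternating_sum I v fps_exp = (\<Prod>i\<in>I. 1 - fps_exp (v i))"
  using assms
proof (induction I rule: finite_induct)
  case empty
  show ?case by (simp add: alternating_sum_def)
next
  case (insert i I)
  have "alternating_sum I v (\<lambda>x. fps_exp (v i + x)) = fps_exp (v i) * alternating_sum I v fps_exp"
    by (simp add: alternating_sum_def fps_exp_add_mult sum_distrib_left mult_ac)
  thus ?case
    using insert by (simp add: alternating_sum_insert algebra_simps)
qed

lemma fps_nth_alternating_sum:
  "fps_nth (alternating_sum I v fps_exp) k = alternating_sum I v (\<lambda>x. x ^ k) / fact k"
proof -
  have "fps_nth ((-1) ^ n * fps_exp a) k = (-1) ^ n * (a ^ k / fact k)" for n and a :: complex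
    by (cases "even n") auto
  thus ?thesis
    by (simp add: alternating_sum_def fps_sum_nth sum_divide_distrib)
qed

text \<open>Each factor \<open>1 - fps_exp (v i)\<close> has constant term zero, so the product is
  divisible by \<open>fps_X ^ card I\<close> and its lower coefficients vanish.\<close>

lemma alternating_sum_power_eq_0:
  assumes "finite I" "k < card I"
  shows "alternating_sum I v (\<lambda>x. x ^ k) = 0"
proof -
  have "fps_X ^ card I dvd (\<Prod>i\<in>I. 1 - fps_exp (v i))"
    unfolding prod_constant[symmetric]
  proof (intro prod_dvd_prod)
    fix i
    have "1 - fps_exp (v i) = fps_X * fps_shift 1 (1 - fps_exp (v i))"
      by (rule fps_ext) (simp add: fps_X_mult_nth)
    thus "fps_X dvd 1 - fps_exp (v i)"
      by (rule dvdI)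
  qed
  then obtain h where "(\<Prod>i\<in>I. 1 - fps_exp (v i)) = fps_X ^ card I * h"
    by (elim dvdE)
  hence "fps_nth (alternating_sum I v fps_exp) k = 0"
    using assms by (simp add: alternating_sum_fps_exp fps_X_power_mult_nth)
  thus ?thesis
    by (simp add: fps_nth_alternating_sum)
qed

subsection \<open>The half-plane\<close>

lemma half_plane_eq:
  "half_plane \<theta> = {z. Re (z * cis (- \<theta>)) > 0}"
proof (intro equalityI subsetI)
  fix z assume "z \<in> half_plane \<theta>"
  then obtain r \<phi> where z: "z = of_real r * cis \<phi>" "0 < r" "\<theta> - pi / 2 < \<phi>" "\<phi> < \<theta> + pi / 2"
    by (auto simp: half_plane_def)
  have "Re (z * cis (- \<theta>)) = Re (of_real r * cis (\<phi> - \<theta>))"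
    unfolding z by (simp only: mult.assoc cis_mult) simp
  also have "\<dots> = r * cos (\<phi> - \<theta>)"
    by simp
  also have "\<dots> > 0"
    using z by (intro mult_pos_pos cos_gt_zero_pi) auto
  finally show "z \<in> {z. Re (z * cis (- \<theta>)) > 0}"
    by simp
next
  fix z assume "z \<in> {z. Re (z * cis (- \<theta>)) > 0}"
  define y where "y = z * cis (- \<theta>)"
  have y: "Re y > 0"
    using \<open>z \<in> _\<close> by (simp add: y_def)
  hence "y \<noteq> 0"
    by auto
  hence "y = of_real (norm y) * cis (Arg y)"
    using rcis_cmod_Arg[of y] by (simp add: rcis_def)
  moreover have "z = y * cis \<theta>"
    by (simp add: y_def cis_mult mult.assoc)
  ultimately have "z = of_real (norm y) * cis (Arg y + \<theta>)"
    by (metis cis_mult mult.assoc)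
  moreover have "\<bar>Arg y\<bar> < pi / 2"
    using Re_Ln_pos_lt[of y] y \<open>y \<noteq> 0\<close> by (simp add: Arg_eq_Im_Ln)
  ultimately show "z \<in> half_plane \<theta>"
    unfolding half_plane_def using \<open>y \<noteq> 0\<close> by (intro CollectI exI[of _ "norm y"] exI[of _ "Arg y + \<theta>"]) auto
qed

text \<open>The signed distance to the boundary line of the half-plane. Being additive, it bounds
  \<open>|n . w|\<close> from below with no loss by cancellation, which is why the estimates are
  phrased in it.\<close>

definition height :: "real \<Rightarrow> complex \<Rightarrow> real" where
  "height \<theta> z = Re (z * cis (- \<theta>))"

lemma height_add [simp]: "height \<theta> (x + y) = height \<theta> x + height \<theta> y"
  and height_0 [simp]: "height \<theta> 0 = 0"
  and height_scaleR [simp]: "height \<theta> (r *\<^sub>R x) = r * height \<theta> x"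
  by (simp_all add: height_def algebra_simps)

lemma height_of_real_mult [simp]: "height \<theta> (of_real r * x) = r * height \<theta> x"
  using height_scaleR[of \<theta> r x] by (simp add: scaleR_conv_of_real)

lemma height_of_nat_mult [simp]: "height \<theta> (of_nat n * x) = real n * height \<theta> x"
  using height_of_real_mult[of \<theta> "real n" x] by simp

lemma height_sum: "height \<theta> (\<Sum>i\<in>I. f i) = (\<Sum>i\<in>I. height \<theta> (f i))"
  by (induction I rule: infinite_finite_induct) auto

lemma height_le_norm: "height \<theta> z \<le> norm z"
  using complex_Re_le_cmod[of "z * cis (- \<theta>)"] by (simp add: height_def norm_mult)

lemma mem_half_plane_iff: "z \<in> half_plane \<theta> \<longleftrightarrow> height \<theta> z > 0"
  by (simp add: half_plane_eq height_def)

lemma half_plane_nonzero: "z \<in> half_plane \<theta> \<Longrightarrow> z \<noteq> 0"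
  by (auto simp: mem_half_plane_iff)

lemma open_half_plane: "open (half_plane \<theta>)"
  unfolding half_plane_eq by (intro open_Collect_less continuous_intros)

lemma convex_height_ge: "convex {z. height \<theta> z \<ge> c}"
proof (rule convexI)
  fix x y and u v :: real
  assume *: "x \<in> {z. height \<theta> z \<ge> c}" "y \<in> {z. height \<theta> z \<ge> c}" "0 \<le> u" "0 \<le> v" "u + v = 1"
  have "c = u * c + v * c"
    using * by (simp add: distrib_right[symmetric])
  also have "\<dots> \<le> u * height \<theta> x + v * height \<theta> y"
    using * by (intro add_mono mult_left_mono) auto
  finally show "u *\<^sub>R x + v *\<^sub>R y \<in> {z. height \<theta> z \<ge> c}"
    by simp
qed

lemma convex_half_plane: "convex (half_plane \<theta>)"
  unfolding convex_alt
proof safe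
  fix x y :: complex and u :: real
  assume *: "x \<in> half_plane \<theta>" "y \<in> half_plane \<theta>" "0 \<le> u" "u \<le> 1"
  have "min (height \<theta> x) (height \<theta> y) \<le> height \<theta> ((1 - u) *\<^sub>R x + u *\<^sub>R y)"
    using convexD_alt[OF convex_height_ge[of "min (height \<theta> x) (height \<theta> y)" \<theta>], of x y u] * by auto
  thus "(1 - u) *\<^sub>R x + u *\<^sub>R y \<in> half_plane \<theta>"
    using * by (auto simp: mem_half_plane_iff)
qed

section \<open>Branches of the logarithm and complex powers on the half-plane\<close>

locale barnes_setting =
  fixes \<theta> :: real and L :: "complex \<Rightarrow> complex" and d :: nat and w :: "nat \<Rightarrow> complex"
  assumes branch: "log_branch_on L (half_plane \<theta>)"
    and d_pos: "d \<ge> 1"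
    and w_mem: "\<And>i. i \<in> {1..d} \<Longrightarrow> w i \<in> half_plane \<theta>"
begin

lemma exp_L: "z \<in> half_plane \<theta> \<Longrightarrow> exp (L z) = z"
  using branch by (simp add: log_branch_on_def)

lemma L_deriv:
  assumes "z \<in> half_plane \<theta>"
  shows "(L has_field_derivative 1 / z) (at z)"
proof -
  have "L holomorphic_on half_plane \<theta>"
    using branch by (simp add: log_branch_on_def)
  hence D: "(L has_field_derivative deriv L z) (at z)"
    using open_half_plane assms by (rule holomorphic_derivI)
  hence "((\<lambda>z. exp (L z)) has_field_derivative exp (L z) * deriv L z) (at z)"
    by (auto intro!: derivative_eq_intros)
  moreover have "((\<lambda>z. z) has_field_derivative 1) (at z)"
    by (rule DERIV_ident)
  hence "((\<lambda>z. exp (L z)) has_field_derivative 1) (at z)"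
    by (rule has_field_derivative_transform_within_open[OF _ open_half_plane assms]) (simp add: exp_L)
  ultimately have "exp (L z) * deriv L z = 1"
    by (rule DERIV_unique)
  hence "deriv L z = 1 / z"
    using half_plane_nonzero[OF assms] by (simp add: exp_L[OF assms] field_simps)
  thus ?thesis
    using D by simp
qed

text \<open>Both functions have derivative \<open>1 / z\<close> on a convex set. This transfers
  properties of the principal logarithm on the right half-plane to an arbitrary branch.\<close>

lemma L_eq_Ln:
  shows "\<exists>c. \<forall>z\<in>half_plane \<theta>. L z = Ln (z * cis (- \<theta>)) + c"
proof -
  have "((\<lambda>z. L z - Ln (z * cis (- \<theta>))) has_field_derivative 0) (at z within half_plane \<theta>)"
    if z: "z \<in> half_plane \<theta>" for z
  proof -
    define c where "c = cis (- \<theta>)"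
    have c: "c \<noteq> 0"
      by (simp add: c_def)
    have "z * c \<notin> \<real>\<^sub>\<le>\<^sub>0"
      using z by (metis c_def complex_nonpos_Reals_iff height_def mem_half_plane_iff not_less)
    hence "((\<lambda>z. Ln (z * c)) has_field_derivative inverse (z * c) * c) (at z)"
      by (rule DERIV_chain2[OF has_field_derivative_Ln]) (rule DERIV_cmult_right[OF DERIV_ident, simplified])
    from DERIV_diff[OF L_deriv[OF z] this] show ?thesis
      using c half_plane_nonzero[OF z]
      by (simp add: c_def[symmetric] field_simps has_field_derivative_at_within)
  qed
  hence "\<exists>c. \<forall>z\<in>half_plane \<theta>. L z - Ln (z * cis (- \<theta>)) = c"
    by (rule has_field_derivative_zero_constant[OF convex_half_plane])
  then obtain c where "\<And>z. z \<in> half_plane \<theta> \<Longrightarrow> L z - Ln (z * cis (- \<theta>)) = c"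
    by blast
  thus ?thesis
    by (intro exI[of _ c]) (auto simp: algebra_simps)
qed

text \<open>A positive factor leaves the argument alone, so the principal logarithm gains exactly
  \<open>ln r\<close>, without a multiple of \<open>2 pi i\<close>, and the additive constant
  cancels.\<close>

lemma L_scale:
  assumes "z \<in> half_plane \<theta>" "r > 0"
  shows "L (of_real r * z) = of_real (ln r) + L z"
proof -
  obtain c where c: "\<And>z. z \<in> half_plane \<theta> \<Longrightarrow> L z = Ln (z * cis (- \<theta>)) + c"
    using L_eq_Ln by blast
  have "of_real r * z \<in> half_plane \<theta>"
    using assms by (simp add: mem_half_plane_iff)
  moreover have "Ln (of_real r * (z * cis (- \<theta>))) = of_real (ln r) + Ln (z * cis (- \<theta>))"
    using Ln_times_of_real[of r "z * cis (- \<theta>)"] assms half_plane_nonzero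
    by (auto simp: Ln_of_real)
  ultimately show ?thesis
    using assms by (simp add: c mult.assoc)
qed

lemma Re_L: "z \<in> half_plane \<theta> \<Longrightarrow> Re (L z) = ln (norm z)"
  using exp_L[of z] by (metis ln_exp norm_exp_eq_Re)

text \<open>One constant serves for all points because \<open>L\<close> differs from a rotated
  principal logarithm by a constant; \<open>Im_L_le\<close> justifies the choice.\<close>

definition arg_bound :: real where
  "arg_bound = (SOME A. \<forall>z\<in>half_plane \<theta>. \<bar>Im (L z)\<bar> \<le> A)"

lemma Im_L_le: 
  assumes "z \<in> half_plane \<theta>"
  shows "\<bar>Im (L z)\<bar> \<le> arg_bound"
proof -
  obtain c where c: "\<And>z. z \<in> half_plane \<theta> \<Longrightarrow> L z = Ln (z * cis (- \<theta>)) + c"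
    using L_eq_Ln by blast
  have "\<bar>Im (L z)\<bar> \<le> pi + \<bar>Im c\<bar>" if "z \<in> half_plane \<theta>" for z
    using mpi_less_Im_Ln[of "z * cis (- \<theta>)"] Im_Ln_le_pi[of "z * cis (- \<theta>)"]
      half_plane_nonzero[OF that] by (simp add: c[OF that])
  hence "\<exists>A. \<forall>z\<in>half_plane \<theta>. \<bar>Im (L z)\<bar> \<le> A"
    by blast
  hence "\<forall>z\<in>half_plane \<theta>. \<bar>Im (L z)\<bar> \<le> arg_bound"
    unfolding arg_bound_def by (rule someI_ex)
  with assms show ?thesis
    by blast
qed

lemma norm_branch_power_le:
  assumes "z \<in> half_plane \<theta>"
  shows "norm (branch_power L z s) \<le> exp (arg_bound * \<bar>Im s\<bar>) * norm z powr Re s"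
proof -
  have "- (Im s * Im (L z)) \<le> \<bar>Im (L z)\<bar> * \<bar>Im s\<bar>"
    by (metis abs_ge_minus_self abs_mult mult.commute)
  also have "\<dots> \<le> arg_bound * \<bar>Im s\<bar>"
    using Im_L_le[OF assms] by (intro mult_right_mono) auto
  finally have "Re (s * L z) \<le> Re s * ln (norm z) + arg_bound * \<bar>Im s\<bar>"
    by (simp add: Re_L[OF assms])
  thus ?thesis
    using half_plane_nonzero[OF assms]
    by (simp add: branch_power_def powr_def exp_add[symmetric] add.commute)
qed

lemma branch_power_deriv:
  assumes "z \<in> half_plane \<theta>"
  shows "((\<lambda>z. branch_power L z s) has_field_derivative s * branch_power L z (s - 1)) (at z)"
proof -
  have "exp ((s - 1) * L z) = exp (s * L z) / z"
    using exp_L[OF assms] by (simp add: algebra_simps exp_diff)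
  thus ?thesis
    unfolding branch_power_def using assms half_plane_nonzero[OF assms]
    by (auto intro!: derivative_eq_intros L_deriv)
qed

text \<open>The \<open>m\<close>-th derivative of \<open>x\<^sup>-\<^sup>s\<close> with respect to \<open>x\<close>.\<close>

definition dpow :: "complex \<Rightarrow> nat \<Rightarrow> complex \<Rightarrow> complex" where
  "dpow s m x = (-1) ^ m * pochhammer s m * branch_power L x (- s - of_nat m)"

lemma dpow_deriv:
  assumes "x \<in> half_plane \<theta>"
  shows "(dpow s m has_field_derivative dpow s (Suc m) x) (at x)"
  unfolding dpow_def [abs_def]
  by (rule derivative_eq_intros branch_power_deriv assms refl)+
     (simp add: pochhammer_Suc algebra_simps)

text \<open>The exponent of the norm is nonpositive, so replacing \<open>norm x\<close> by the
  smaller \<open>r\<close> only enlarges the bound.\<close>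

lemma norm_dpow_le:
  assumes "x \<in> half_plane \<theta>" "0 < r" "r \<le> norm x" "Re s + real m \<ge> 0"
  shows "norm (dpow s m x) \<le>
           norm (pochhammer s m) * exp (arg_bound * \<bar>Im s\<bar>) * r powr (- Re s - real m)"
proof -
  have "norm (branch_power L x (- s - of_nat m)) \<le>
          exp (arg_bound * \<bar>Im s\<bar>) * norm x powr (- Re s - real m)"
    using norm_branch_power_le[OF assms(1), of "- s - of_nat m"] by simp
  also have "\<dots> \<le> exp (arg_bound * \<bar>Im s\<bar>) * r powr (- Re s - real m)"
    using assms by (intro mult_left_mono powr_mono2') auto
  finally show ?thesis
    unfolding dpow_def norm_mult norm_power
    by (simp add: mult_left_mono mult.assoc)
qed

text \<open>Taylor's formula is applied on the translated half-plane of points at least as high as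
  \<open>x\<close>. It is convex, contains \<open>x\<close> and \<open>x + h\<close>, and all its
  points have norm at least \<open>height \<theta> x\<close>, so one bound serves for the derivative
  of order \<open>m + J\<close>.\<close>

lemma dpow_Taylor:
  assumes x: "x \<in> half_plane \<theta>" and h: "height \<theta> h \<ge> 0" and J: "J > 0"
    and s: "Re s + real (m + J) \<ge> 0"
  shows "norm (dpow s m (x + h) - (\<Sum>j<J. dpow s (m + j) x * h ^ j / fact j)) \<le>
           norm (pochhammer s (m + J)) * exp (arg_bound * \<bar>Im s\<bar>) *
             height \<theta> x powr (- Re s - real (m + J)) * norm h ^ J / fact (J - 1)"
proof -
  obtain n where n: "J = Suc n"
    using J by (cases J) auto
  let ?S = "{z. height \<theta> z \<ge> height \<theta> x}"
  have S: "z \<in> half_plane \<theta>" if "z \<in> ?S" for z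
    using that x by (simp add: mem_half_plane_iff)
  have "norm (dpow s (m + 0) (x + h) - (\<Sum>j\<le>n. dpow s (m + j) x * (x + h - x) ^ j / fact j)) \<le>
          (norm (pochhammer s (m + J)) * exp (arg_bound * \<bar>Im s\<bar>) *
             height \<theta> x powr (- Re s - real (m + J))) * norm (x + h - x) ^ Suc n / fact n"
  proof (rule complex_Taylor[OF convex_height_ge])
    fix i z assume "z \<in> ?S" "i \<le> n"
    thus "(dpow s (m + i) has_field_derivative dpow s (m + Suc i) z) (at z within ?S)"
      using dpow_deriv[OF S, of z s "m + i"] by (simp add: has_field_derivative_at_within)
  next
    fix z assume "z \<in> ?S"
    thus "norm (dpow s (m + Suc n) z) \<le> norm (pochhammer s (m + J)) * exp (arg_bound * \<bar>Im s\<bar>) *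
             height \<theta> x powr (- Re s - real (m + J))"
      using norm_dpow_le[of z "height \<theta> x" s "m + J"] S[of z] height_le_norm[of \<theta> z] x s
      by (simp add: n mem_half_plane_iff)
  qed (use h in auto)
  thus ?thesis
    by (simp add: n lessThan_Suc_atMost)
qed

section \<open>Bernoulli coefficients and the difference equation\<close>

definition bern :: "complex fps" where
  "bern = fps_const (1 / (\<Prod>i=1..d. w i)) *
            (\<Prod>i=1..d. (fps_const (w i) * fps_X) / (fps_exp (w i) - 1))"

lemma w_nonzero: "i \<in> {1..d} \<Longrightarrow> w i \<noteq> 0"
  using w_mem half_plane_nonzero by blast

lemma bernoullian_deriv_0_eq_bern: "bernoullian_deriv_0 d w m = fact m * fps_nth bern m"
  using bernoullian_deriv_0_eq[OF d_pos]
  by (simp add: higher_bernoulli_def higher_bernoulli_gf_def bern_def)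

text \<open>Each factor \<open>z / (exp(w_i z) - 1)\<close> of \<open>bern\<close> meets its
  \<open>1 - exp(w_i z)\<close> and leaves \<open>-z\<close>. Read with \<open>D\<close> for
  \<open>z\<close>, this says that \<open>bern\<close> inverts the difference operator up to
  \<open>(-D)^d\<close>.\<close>

lemma bern_mult: "bern * alternating_sum {1..d} w fps_exp = (-1) ^ d * fps_X ^ d"
proof -
  have "(fps_const c * fps_X) / (fps_exp c - 1) * (1 - fps_exp c) = fps_const c * (- fps_X)"
    if "c \<noteq> 0" for c :: complex
  proof -
    \<comment> \<open>Equal subdegrees make the division of power series exact.\<close>
    have "subdegree (fps_const c * fps_X) = 1"
      by (rule subdegreeI) (use that in auto)
    moreover have "subdegree (fps_exp c - 1) = 1"
      by (rule subdegreeI) (use that in auto)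
    moreover from this have "fps_exp c - 1 \<noteq> 0"
      by auto
    moreover have "fps_const c * fps_X \<noteq> 0"
      using that by simp
    ultimately have "fps_exp c - 1 dvd fps_const c * fps_X"
      by (simp add: fps_dvd_iff)
    hence "(fps_const c * fps_X) / (fps_exp c - 1) * (fps_exp c - 1) = fps_const c * fps_X"
      by (rule dvd_div_mult_self)
    thus ?thesis
      by (simp add: algebra_simps)
  qed
  hence "(\<Prod>i=1..d. (fps_const (w i) * fps_X) / (fps_exp (w i) - 1)) * alternating_sum {1..d} w fps_exp =
          (\<Prod>i=1..d. fps_const (w i) * (- fps_X))"
    using w_nonzero by (simp add: alternating_sum_fps_exp prod.distrib[symmetric])
  also have "\<dots> = fps_const (\<Prod>i=1..d. w i) * ((-1) ^ d * fps_X ^ d)"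
  proof -
    have "(\<Prod>i\<in>I. fps_const (w i)) = fps_const (\<Prod>i\<in>I. w i)" for I
      by (induction I rule: infinite_finite_induct) auto
    thus ?thesis
      unfolding prod.distrib by (simp add: power_minus[of fps_X])
  qed
  finally have "bern * alternating_sum {1..d} w fps_exp =
                  fps_const (1 / (\<Prod>i=1..d. w i)) * (fps_const (\<Prod>i=1..d. w i) * ((-1) ^ d * fps_X ^ d))"
    by (simp only: bern_def mult.assoc)
  also have "\<dots> = fps_const (1 / (\<Prod>i=1..d. w i) * (\<Prod>i=1..d. w i)) * ((-1) ^ d * fps_X ^ d)"
    by (simp only: mult.assoc[symmetric] fps_const_mult)
  also have "1 / (\<Prod>i=1..d. w i) * (\<Prod>i=1..d. w i) = 1"
    using w_nonzero by simp
  finally show ?thesis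
    by simp
qed

lemma alternating_sum_power_convolution:
  "(\<Sum>m\<le>k. fps_nth bern m * (alternating_sum {1..d} w (\<lambda>x. x ^ (k - m)) / fact (k - m))) =
     (if k = d then (-1) ^ d else 0)"
proof -
  have "fps_nth ((-1) ^ d * fps_X ^ d) k = (if k = d then (-1) ^ d else (0::complex))"
    by (cases "even d") auto
  thus ?thesis
    unfolding bern_mult[symmetric]
    by (simp add: fps_mult_nth fps_nth_alternating_sum atLeast0AtMost)
qed

definition euler_maclaurin :: "nat \<Rightarrow> complex \<Rightarrow> complex \<Rightarrow> complex" where
  "euler_maclaurin N s x = (\<Sum>m\<le>N. fps_nth bern m * dpow s m x)"

text \<open>The error that \<open>euler_maclaurin\<close> leaves in the difference equation. With
  \<open>s = \<alpha> - d\<close> the first term is the summand \<open>x^(-\<alpha>)\<close> of the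
  zeta series times the product of all \<open>\<alpha> - j\<close>, \<open>j = 1..d\<close>.\<close>

definition remainder :: "nat \<Rightarrow> complex \<Rightarrow> complex \<Rightarrow> complex" where
  "remainder N s x =
     (-1) ^ d * dpow s d x - alternating_sum {1..d} w (\<lambda>h. euler_maclaurin N s (x + h))"

text \<open>The Taylor bounds of \<open>dpow_Taylor\<close> added up over the vertices and orders.
  What matters is that it does not depend on \<open>x\<close> and is continuous in
  \<open>s\<close>.\<close>

definition remainder_bound :: "nat \<Rightarrow> complex \<Rightarrow> real" where
  "remainder_bound N s =
     norm (pochhammer s (N + d + 1)) * exp (arg_bound * \<bar>Im s\<bar>) *
       (\<Sum>m\<le>N. norm (fps_nth bern m) *
          (\<Sum>S\<in>Pow {1..d}. norm (sum w S) ^ (N + d + 1 - m) / fact (N + d - m)))"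

text \<open>The Taylor polynomials stop at total order \<open>m + j = N + d\<close>. Grouped by the
  total order \<open>k\<close>, their coefficients are those of
  \<open>alternating_sum_power_convolution\<close>, so only \<open>k = d\<close> survives.\<close>

lemma euler_maclaurin_main_terms:
  "(\<Sum>m\<le>N. fps_nth bern m * alternating_sum {1..d} w
       (\<lambda>h. \<Sum>j<N + d + 1 - m. dpow s (m + j) x * h ^ j / fact j)) = (-1) ^ d * dpow s d x"
proof -
  define a where "a = (\<lambda>j. alternating_sum {1..d} w (\<lambda>h. h ^ j) / fact j)"
  define K where "K = N + d + 1"
  have a0: "a j = 0" if "j < d" for j
    using that by (simp add: a_def alternating_sum_power_eq_0)
  have a: "alternating_sum {1..d} w (\<lambda>h. \<Sum>j<J. dpow s (m + j) x * h ^ j / fact j) =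
             (\<Sum>j<J. dpow s (m + j) x * a j)" for m J
    unfolding alternating_sum_def a_def sum_distrib_left sum_divide_distrib
    by (subst sum.swap) (simp add: mult_ac)
  have "(\<Sum>m\<le>N. fps_nth bern m * alternating_sum {1..d} w
           (\<lambda>h. \<Sum>j<N + d + 1 - m. dpow s (m + j) x * h ^ j / fact j)) =
        (\<Sum>m\<le>N. \<Sum>j<K - m. fps_nth bern m * (dpow s (m + j) x * a j))"
    by (simp only: a sum_distrib_left K_def)
  \<comment> \<open>The added terms have \<open>m > N\<close>, hence \<open>j < K - m <= d\<close>,
    where \<open>a j\<close> vanishes.\<close>
  also have "\<dots> = (\<Sum>m<K. \<Sum>j<K - m. fps_nth bern m * (dpow s (m + j) x * a j))"
    by (intro sum.mono_neutral_left) (auto simp: K_def intro!: sum.neutral a0)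
  also have "\<dots> = (\<Sum>(m, j)\<in>{(m, j). m + j < K}. fps_nth bern m * (dpow s (m + j) x * a j))"
    by (subst sum.Sigma) (auto intro!: sum.cong)
  also have "\<dots> = (\<Sum>k<K. \<Sum>m\<le>k. fps_nth bern m * (dpow s k x * a (k - m)))"
    unfolding sum.triangle_reindex by (intro sum.cong) auto
  also have "\<dots> = (\<Sum>k<K. dpow s k x * (\<Sum>m\<le>k. fps_nth bern m * a (k - m)))"
    by (simp add: sum_distrib_left mult_ac)
  also have "\<dots> = (\<Sum>k<K. if k = d then (-1) ^ d * dpow s d x else 0)"
    unfolding a_def alternating_sum_power_convolution by (intro sum.cong) auto
  also have "\<dots> = (-1) ^ d * dpow s d x"
    by (simp add: K_def)
  finally show ?thesis .
qed

lemma height_sum_w_nonneg: "S \<subseteq> {1..d} \<Longrightarrow> height \<theta> (sum w S) \<ge> 0"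
  unfolding height_sum using w_mem by (intro sum_nonneg) (auto simp: mem_half_plane_iff less_imp_le)

text \<open>The Taylor polynomials cancel against the term with \<open>dpow s d x\<close>; what is
  left are Taylor remainders, all of total order \<open>N + d + 1\<close>.\<close>

lemma norm_remainder_le:
  assumes x: "x \<in> half_plane \<theta>" and s: "Re s + real (N + d + 1) \<ge> 0"
  shows "norm (remainder N s x) \<le> remainder_bound N s * height \<theta> x powr (- Re s - real (N + d + 1))"
proof -
  let ?K = "N + d + 1"
  define C where "C = norm (pochhammer s ?K) * exp (arg_bound * \<bar>Im s\<bar>) *
                        height \<theta> x powr (- Re s - real ?K)"
  define T where "T = (\<lambda>m h. \<Sum>j<?K - m. dpow s (m + j) x * h ^ j / fact j)"
  have T: "norm (T m (sum w S) - dpow s m (x + sum w S)) \<le>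
             C * (norm (sum w S) ^ (?K - m) / fact (N + d - m))"
    if "m \<le> N" "S \<subseteq> {1..d}" for m S
    using dpow_Taylor[OF x height_sum_w_nonneg[OF that(2)], of "?K - m" s m] that s
    by (simp add: C_def T_def norm_minus_commute)
  have "remainder N s x =
          (\<Sum>m\<le>N. fps_nth bern m * alternating_sum {1..d} w (T m)) -
          alternating_sum {1..d} w (\<lambda>h. euler_maclaurin N s (x + h))"
    by (simp only: remainder_def T_def euler_maclaurin_main_terms)
  moreover have "alternating_sum {1..d} w (\<lambda>h. euler_maclaurin N s (x + h)) =
               (\<Sum>m\<le>N. fps_nth bern m * alternating_sum {1..d} w (\<lambda>h. dpow s m (x + h)))"
    unfolding alternating_sum_def euler_maclaurin_def sum_distrib_left
    by (subst sum.swap) (simp add: mult_ac)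
  ultimately have eq: "remainder N s x =
               (\<Sum>m\<le>N. fps_nth bern m *
                  (\<Sum>S\<in>Pow {1..d}. (-1) ^ card S * (T m (sum w S) - dpow s m (x + sum w S))))"
    by (simp add: alternating_sum_def algebra_simps sum_subtractf)
  have "norm (remainder N s x) \<le> (\<Sum>m\<le>N. norm (fps_nth bern m) *
                  (\<Sum>S\<in>Pow {1..d}. C * (norm (sum w S) ^ (?K - m) / fact (N + d - m))))"
    unfolding eq
    by (intro order.trans[OF norm_sum] sum_mono, unfold norm_mult, intro mult_left_mono
          order.trans[OF norm_sum] sum_mono) (use T in \<open>auto simp: norm_mult norm_power\<close>)
  also have "\<dots> = remainder_bound N s * height \<theta> x powr (- Re s - real ?K)"
    by (simp add: remainder_bound_def C_def sum_distrib_left sum_distrib_right mult_ac)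
  finally show ?thesis .
qed

end

subsection \<open>Sums over the lattice\<close>

text \<open>Every finite set of tuples lies in a box, over which the sum factors into
  one-dimensional partial sums.\<close>

lemma summable_on_prod_PiE_nat:
  fixes f :: "nat \<Rightarrow> real" and I :: "'i set"
  assumes "finite I" "summable f" "\<And>k. f k \<ge> 0"
  shows "(\<lambda>n. \<Prod>i\<in>I. f (n i)) summable_on PiE I (\<lambda>_. UNIV)"
proof (rule nonneg_bdd_above_summable_on)
  show "bdd_above (sum (\<lambda>n. \<Prod>i\<in>I. f (n i)) ` {F. F \<subseteq> PiE I (\<lambda>_. UNIV) \<and> finite F})"
  proof (rule bdd_aboveI2)
    fix F :: "('i \<Rightarrow> nat) set"
    assume "F \<in> {F. F \<subseteq> PiE I (\<lambda>_. UNIV) \<and> finite F}"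
    hence F: "F \<subseteq> PiE I (\<lambda>_. UNIV)" "finite F"
      by auto
    define M where "M = Max ((\<lambda>(n, i). n i) ` (F \<times> I))"
    have M: "n i \<le> M" if "n \<in> F" "i \<in> I" for n i
      unfolding M_def using that F assms(1) by (intro Max_ge) auto
    have "F \<subseteq> PiE I (\<lambda>_. {..M})"
    proof
      fix n assume n: "n \<in> F"
      hence "n \<in> PiE I (\<lambda>_. UNIV)"
        using F by blast
      thus "n \<in> PiE I (\<lambda>_. {..M})"
        using M[OF n] by (simp add: PiE_iff)
    qed
    hence "(\<Sum>n\<in>F. \<Prod>i\<in>I. f (n i)) \<le> (\<Sum>n\<in>PiE I (\<lambda>_. {..M}). \<Prod>i\<in>I. f (n i))"
      using assms by (intro sum_mono2 finite_PiE prod_nonneg) auto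
    also have "\<dots> = (\<Prod>i\<in>I. \<Sum>k\<le>M. f k)"
      using assms by (intro prod_sum_PiE[symmetric]) auto
    also have "\<dots> \<le> (\<Prod>i\<in>I. suminf f)"
      using assms by (intro prod_mono) (auto intro!: sum_nonneg sum_le_suminf)
    finally show "(\<Sum>n\<in>F. \<Prod>i\<in>I. f (n i)) \<le> (\<Prod>i\<in>I. suminf f)" .
  qed
qed (use assms in \<open>auto intro!: prod_nonneg\<close>)

lemma prod_Suc_le_power:
  assumes "finite I"
  shows "(\<Prod>i\<in>I. Suc (n i)) \<le> Suc (\<Sum>i\<in>I. n i) ^ card I"
proof -
  have "(\<Prod>i\<in>I. Suc (n i)) \<le> (\<Prod>i\<in>I. Suc (\<Sum>i\<in>I. n i))"
    using assms by (intro prod_mono) (auto intro: member_le_sum)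
  thus ?thesis
    by simp
qed

text \<open>The sign is \<open>(-1)^d (-1)^|S|\<close>, and \<open>g 0\<close> is the term of the
  empty set.\<close>

lemma subset_sum_op_eq:
  "subset_sum_op d g v = (-1) ^ d * (alternating_sum {1..d} v g - g 0)"
proof -
  have "(-1) ^ (d - card S) = (-1::complex) ^ d * (-1) ^ card S" if "S \<in> Pow {1..d}" for S
  proof -
    have "card S \<le> d"
      using card_mono[of "{1..d}" S] that by auto
    thus ?thesis
      by (simp add: minus_one_power_iff flip: power_add)
  qed
  moreover have "{S. S \<noteq> {} \<and> S \<subseteq> {1..d}} = Pow {1..d} - {{}}"
    by auto
  ultimately have "subset_sum_op d g v = (\<Sum>S\<in>Pow {1..d} - {{}}. (-1) ^ d * ((-1) ^ card S * g (sum v S)))"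
    unfolding subset_sum_op_def by (intro sum.cong) auto
  also have "\<dots> = (-1) ^ d * (alternating_sum {1..d} v g - g 0)"
    by (simp add: alternating_sum_def sum_diff1 flip: sum_distrib_left)
  finally show ?thesis .
qed

text \<open>The cubes eventually contain every finite set of lattice points, so unconditional sums
  may be evaluated along them.\<close>

lemma filterlim_cubes:
  "filterlim (\<lambda>M. cube d (M - 1) - {zero_tuple d})
     (finite_subsets_at_top (lattice d - {zero_tuple d})) sequentially"
  unfolding filterlim_finite_subsets_at_top
proof safe
  fix X assume X: "finite X" "X \<subseteq> lattice d - {zero_tuple d}"
  \<comment> \<open>If \<open>X\<close> is empty this maximum is unspecified, but the bound below is
    then vacuous.\<close>
  define K where "K = Max ((\<lambda>(n, i). n i) ` (X \<times> {1..d}))"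
  have K: "n i \<le> K" if "n \<in> X" "i \<in> {1..d}" for n i
    unfolding K_def using that X by (intro Max_ge) auto
  show "\<forall>\<^sub>F M in sequentially. finite (cube d (M - 1) - {zero_tuple d}) \<and>
          X \<subseteq> cube d (M - 1) - {zero_tuple d} \<and>
          cube d (M - 1) - {zero_tuple d} \<subseteq> lattice d - {zero_tuple d}"
    using eventually_ge_at_top[of "Suc K"]
  proof eventually_elim
    case (elim M)
    have "n \<in> cube d (M - 1)" if "n \<in> X" for n
    proof -
      have "n \<in> lattice d"
        using that X by blast
      moreover have "n i \<le> M - 1" if "i \<in> {1..d}" for i
        using K[OF \<open>n \<in> X\<close> that] elim by linarith
      ultimately show ?thesis
        by (simp add: cube_def lattice_def PiE_iff)
    qed
    moreover have "cube d (M - 1) \<subseteq> lattice d"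
      by (auto simp: cube_def lattice_def PiE_iff)
    ultimately show ?case
      using X by (auto simp: cube_def intro!: finite_PiE)
  qed
qed

lemma finite_cube: "finite (cube d M)"
  by (auto simp: cube_def intro!: finite_PiE)

lemma zero_tuple_in_cube: "zero_tuple d \<in> cube d M"
  by (auto simp: cube_def zero_tuple_def PiE_iff extensional_def)

lemma tuple_dot_zero_tuple [simp]: "tuple_dot d (zero_tuple d) w = 0"
  by (simp add: tuple_dot_def zero_tuple_def)

section \<open>Absolute convergence of the lattice series\<close>

context barnes_setting
begin

text \<open>The entry \<open>1\<close> forces the value to be at most \<open>1\<close>, so that its
  powers decrease in the exponent.\<close>

definition min_height :: real where
  "min_height = Min (insert 1 ((\<lambda>i. height \<theta> (w i)) ` {1..d}))"

lemma min_height_pos: "min_height > 0"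
  unfolding min_height_def using w_mem by (subst Min_gr_iff) (auto simp: mem_half_plane_iff)

lemma min_height_le_1: "min_height \<le> 1"
  unfolding min_height_def by (intro Min_le) auto

lemma min_height_le: "i \<in> {1..d} \<Longrightarrow> min_height \<le> height \<theta> (w i)"
  unfolding min_height_def by (intro Min_le) auto

lemma height_tuple_dot_ge: "height \<theta> (tuple_dot d n w) \<ge> min_height * real (\<Sum>i=1..d. n i)"
proof -
  have "min_height * real (\<Sum>i=1..d. n i) = (\<Sum>i=1..d. real (n i) * min_height)"
    by (simp add: sum_distrib_left mult.commute)
  also have "\<dots> \<le> (\<Sum>i=1..d. real (n i) * height \<theta> (w i))"
    by (intro sum_mono mult_left_mono min_height_le) auto
  finally show ?thesis
    by (simp add: tuple_dot_def height_sum)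
qed

lemma sum_lattice_pos:
  assumes "n \<in> lattice d - {zero_tuple d}"
  shows "(\<Sum>i=1..d. n i) \<ge> 1"
proof (rule ccontr)
  assume "\<not> (\<Sum>i=1..d. n i) \<ge> 1"
  hence "(\<Sum>i=1..d. n i) = 0"
    by linarith
  hence "n i = 0" if "i \<in> {1..d}" for i
    using that by (subst (asm) sum_eq_0_iff) auto
  moreover have "n i = undefined" if "i \<notin> {1..d}" for i
    using assms that by (auto simp: lattice_def PiE_def extensional_def)
  ultimately have "n = zero_tuple d"
    by (auto simp: zero_tuple_def fun_eq_iff)
  thus False
    using assms by simp
qed

lemma height_tuple_dot_ge_min_height:
  assumes "n \<in> lattice d - {zero_tuple d}"
  shows "height \<theta> (tuple_dot d n w) \<ge> min_height"
proof -
  have "min_height * 1 \<le> min_height * real (\<Sum>i=1..d. n i)"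
    using sum_lattice_pos[OF assms] min_height_pos by (intro mult_left_mono) linarith+
  thus ?thesis
    using height_tuple_dot_ge[of n] by simp
qed

lemma tuple_dot_in_half_plane:
  "n \<in> lattice d - {zero_tuple d} \<Longrightarrow> tuple_dot d n w \<in> half_plane \<theta>"
  using height_tuple_dot_ge_min_height[of n] min_height_pos by (simp add: mem_half_plane_iff)

text \<open>The height of \<open>n . w\<close> is at least a constant times
  \<open>1 + sum n_i\<close>, hence times the \<open>d\<close>-th root of the product of all
  \<open>1 + n_i\<close>. The terms are thus dominated by products of terms
  \<open>(1 + k)^(-p/d)\<close>, summable since \<open>p > d\<close>.\<close>

lemma height_powr_summable:
  assumes "p > real d"
  shows "(\<lambda>n. height \<theta> (tuple_dot d n w) powr (- p)) summable_on lattice d - {zero_tuple d}"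
proof -
  define f where "f = (\<lambda>k. real (Suc k) powr (- (p / d)))"
  have "summable f"
    using summable_Suc_iff[of "\<lambda>k. real k powr (- (p / d))"] summable_real_powr_iff[of "- (p / d)"]
      assms d_pos unfolding f_def by simp
  hence "(\<lambda>n. \<Prod>i\<in>{1..d}. f (n i)) summable_on lattice d"
    unfolding lattice_def by (intro summable_on_prod_PiE_nat) (auto simp: f_def)
  hence "(\<lambda>n. (min_height / 2) powr (- p) * (\<Prod>i\<in>{1..d}. f (n i))) summable_on lattice d - {zero_tuple d}"
    by (intro summable_on_cmult_right) (rule summable_on_subset_banach, auto)
  thus ?thesis
  proof (rule summable_on_comparison_test)
    fix n assume n: "n \<in> lattice d - {zero_tuple d}"
    let ?s = "\<Sum>i=1..d. n i"
    have "(\<Prod>i\<in>{1..d}. real (Suc (n i))) = real (\<Prod>i\<in>{1..d}. Suc (n i))"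
      by simp
    also have "\<dots> \<le> real (Suc ?s ^ card {1..d})"
      by (intro of_nat_mono prod_Suc_le_power) simp
    also have "\<dots> = real (Suc ?s) powr real d"
      by (subst powr_realpow, simp only: of_nat_0_less_iff zero_less_Suc) simp
    finally have "(\<Prod>i\<in>{1..d}. real (Suc (n i))) \<le> real (Suc ?s) powr real d" .
    hence "(real (Suc ?s) powr real d) powr (- (p / d)) \<le>
             (\<Prod>i\<in>{1..d}. real (Suc (n i))) powr (- (p / d))"
      using assms by (intro powr_mono2') (auto intro!: prod_pos)
    hence *: "real (Suc ?s) powr (- p) \<le> (\<Prod>i\<in>{1..d}. f (n i))"
      using d_pos by (simp add: powr_powr f_def prod_powr_distrib)
    \<comment> \<open>Away from the origin \<open>?s >= 1\<close>, so
      \<open>1 + ?s <= 2 * ?s\<close>.\<close>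
    have "min_height / 2 * real (Suc ?s) \<le> min_height * real ?s"
      using sum_lattice_pos[OF n] min_height_pos by (simp add: field_simps del: of_nat_sum)
    also have "\<dots> \<le> height \<theta> (tuple_dot d n w)"
      by (rule height_tuple_dot_ge)
    finally have "height \<theta> (tuple_dot d n w) powr (- p) \<le> (min_height / 2 * real (Suc ?s)) powr (- p)"
      using min_height_pos assms by (intro powr_mono2') (auto intro!: mult_pos_pos add_pos_nonneg sum_nonneg)
    also have "\<dots> = (min_height / 2) powr (- p) * real (Suc ?s) powr (- p)"
      by (rule powr_mult)
    also have "\<dots> \<le> (min_height / 2) powr (- p) * (\<Prod>i\<in>{1..d}. f (n i))"
      using * by (intro mult_left_mono) auto
    finally show "height \<theta> (tuple_dot d n w) powr (- p) \<le> \<dots>" .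
  qed auto
qed

lemma barnes_series_limit:
  assumes "Re \<alpha> > real d"
  shows "(\<lambda>M. \<Sum>n\<in>cube d (M - 1) - {zero_tuple d}. branch_power L (tuple_dot d n w) (- \<alpha>))
           \<longlonglongrightarrow> barnes_series L d w \<alpha>"
proof -
  have "(\<lambda>n. branch_power L (tuple_dot d n w) (- \<alpha>)) summable_on lattice d - {zero_tuple d}"
  proof (rule abs_summable_summable, rule summable_on_comparison_test)
    show "(\<lambda>n. exp (arg_bound * \<bar>Im \<alpha>\<bar>) * height \<theta> (tuple_dot d n w) powr (- Re \<alpha>))
            summable_on lattice d - {zero_tuple d}"
      by (intro summable_on_cmult_right height_powr_summable assms)
    fix n assume n: "n \<in> lattice d - {zero_tuple d}"
    let ?x = "tuple_dot d n w"
    have x: "?x \<in> half_plane \<theta>"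
      by (rule tuple_dot_in_half_plane[OF n])
    have "norm (branch_power L ?x (- \<alpha>)) \<le> exp (arg_bound * \<bar>Im \<alpha>\<bar>) * norm ?x powr (- Re \<alpha>)"
      using norm_branch_power_le[OF x, of "- \<alpha>"] by simp
    also have "\<dots> \<le> exp (arg_bound * \<bar>Im \<alpha>\<bar>) * height \<theta> ?x powr (- Re \<alpha>)"
      using x assms by (intro mult_left_mono powr_mono2' height_le_norm) (auto simp: mem_half_plane_iff)
    finally show "norm (branch_power L ?x (- \<alpha>)) \<le> \<dots>" .
  qed auto
  hence "((\<lambda>n. branch_power L (tuple_dot d n w) (- \<alpha>)) has_sum barnes_series L d w \<alpha>)
           (lattice d - {zero_tuple d})"
    unfolding barnes_series_def by (rule has_sum_infsum)
  thus ?thesis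
    unfolding has_sum_def by (rule filterlim_compose) (rule filterlim_cubes)
qed

text \<open>The remainders of order \<open>N\<close> decay like the height to the power
  \<open>- Re \<alpha> - N - 1\<close>; here this exponent is below \<open>-d\<close>.\<close>

definition region :: "nat \<Rightarrow> complex set" where
  "region N = {\<alpha>. Re \<alpha> > real d - real N - 1}"

lemma open_region: "open (region N)"
  unfolding region_def by (rule open_halfspace_Re_gt)

lemma continuous_remainder_bound: "continuous_on A (\<lambda>\<alpha>. remainder_bound N (\<alpha> - of_nat d))"
  unfolding remainder_bound_def pochhammer_prod by (intro continuous_intros)

definition remainder_sum :: "nat \<Rightarrow> complex \<Rightarrow> complex" where
  "remainder_sum N \<alpha> =
     (\<Sum>\<^sub>\<infinity>n\<in>lattice d - {zero_tuple d}. remainder N (\<alpha> - of_nat d) (tuple_dot d n w))"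

lemma remainder_sum_uniform_limit:
  assumes "cball \<alpha> r \<subseteq> region N" "r \<ge> 0"
  shows "uniform_limit (cball \<alpha> r)
           (\<lambda>M \<beta>. \<Sum>n\<in>cube d (M - 1) - {zero_tuple d}. remainder N (\<beta> - of_nat d) (tuple_dot d n w))
           (remainder_sum N) sequentially"
proof -
  let ?A = "lattice d - {zero_tuple d}"
  \<comment> \<open>The least value of \<open>Re \<beta> + N + 1\<close> on the ball, attained at
    its leftmost point.\<close>
  define p where "p = Re \<alpha> - r + real N + 1"
  have "\<alpha> - of_real r \<in> region N"
    using assms by (intro subsetD[OF assms(1)]) (auto simp: dist_norm)
  hence p: "p > real d"
    by (simp add: region_def p_def)
  have "compact ((\<lambda>\<beta>. remainder_bound N (\<beta> - of_nat d)) ` cball \<alpha> r)"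
    by (intro compact_continuous_image continuous_remainder_bound compact_cball)
  hence "bdd_above ((\<lambda>\<beta>. remainder_bound N (\<beta> - of_nat d)) ` cball \<alpha> r)"
    by (intro bounded_imp_bdd_above compact_imp_bounded)
  then obtain C where "\<forall>y\<in>(\<lambda>\<beta>. remainder_bound N (\<beta> - of_nat d)) ` cball \<alpha> r. y \<le> C"
    unfolding bdd_above_def by (elim exE)
  hence C: "remainder_bound N (\<beta> - of_nat d) \<le> C" if "\<beta> \<in> cball \<alpha> r" for \<beta>
    using that by blast
  have C_nonneg: "C \<ge> 0"
  proof -
    have "0 \<le> remainder_bound N (\<alpha> - of_nat d)"
      unfolding remainder_bound_def by (intro mult_nonneg_nonneg sum_nonneg) auto
    also have "\<dots> \<le> C"
      using C assms by simp
    finally show ?thesis .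
  qed
  have "uniform_limit (cball \<alpha> r)
          (\<lambda>X \<beta>. \<Sum>n\<in>X. remainder N (\<beta> - of_nat d) (tuple_dot d n w))
          (\<lambda>\<beta>. \<Sum>\<^sub>\<infinity>n\<in>?A. remainder N (\<beta> - of_nat d) (tuple_dot d n w)) (finite_subsets_at_top ?A)"
  proof (rule Weierstrass_m_test_general)
    show "(\<lambda>n. C * min_height powr (- (2 * r)) * height \<theta> (tuple_dot d n w) powr (- p)) summable_on ?A"
      by (intro summable_on_cmult_right height_powr_summable p)
  next
    fix n \<beta> assume n: "n \<in> ?A" and \<beta>: "\<beta> \<in> cball \<alpha> r"
    define t where "t = height \<theta> (tuple_dot d n w)"
    have t: "t \<ge> min_height"
      unfolding t_def by (rule height_tuple_dot_ge_min_height[OF n])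
    have "\<bar>Re \<alpha> - Re \<beta>\<bar> \<le> r"
      using abs_Re_le_cmod[of "\<alpha> - \<beta>"] \<beta> by (simp add: dist_norm)
    hence a: "Re \<beta> + real N + 1 - p \<ge> 0" "Re \<beta> + real N + 1 - p \<le> 2 * r"
      by (auto simp: p_def abs_le_iff)
    have "Re (\<beta> - of_nat d) + real (N + d + 1) \<ge> 0"
      using a p by simp
    hence "norm (remainder N (\<beta> - of_nat d) (tuple_dot d n w)) \<le>
             remainder_bound N (\<beta> - of_nat d) * t powr (- Re (\<beta> - of_nat d) - real (N + d + 1))"
      unfolding t_def by (intro norm_remainder_le tuple_dot_in_half_plane n)
    also have "\<dots> \<le> C * t powr (- Re (\<beta> - of_nat d) - real (N + d + 1))"
      using C[OF \<beta>] by (intro mult_right_mono) auto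
    also have "t powr (- Re (\<beta> - of_nat d) - real (N + d + 1)) =
                 t powr (- (Re \<beta> + real N + 1 - p)) * t powr (- p)"
      by (simp add: algebra_simps flip: powr_add)
    \<comment> \<open>The excess over \<open>p\<close> lies between \<open>0\<close> and
      \<open>2 * r\<close>; together with \<open>t >= min_height\<close> and
      \<open>min_height <= 1\<close> this removes \<open>\<beta>\<close> from the bound.\<close>
    also have "t powr (- (Re \<beta> + real N + 1 - p)) \<le> min_height powr (- (Re \<beta> + real N + 1 - p))"
      using a t min_height_pos by (intro powr_mono2') auto
    also have "\<dots> \<le> min_height powr (- (2 * r))"
      using a min_height_pos min_height_le_1 by (intro powr_mono') auto
    finally show "norm (remainder N (\<beta> - of_nat d) (tuple_dot d n w)) \<le>
                    C * min_height powr (- (2 * r)) * height \<theta> (tuple_dot d n w) powr (- p)"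
      using C_nonneg by (simp add: t_def mult_left_mono mult_right_mono mult.assoc)
  qed
  thus ?thesis
    unfolding remainder_sum_def by (rule filterlim_compose) (rule filterlim_cubes)
qed

end

subsection \<open>The meromorphic continuation\<close>

lemma sum_cube_minus_zero_tuple:
  assumes "M \<ge> 1"
  shows "(\<Sum>n\<in>cube d (M - 1) - {zero_tuple d}. f n) =
           (\<Sum>n\<in>PiE {1..d} (\<lambda>_. {..<M}). f n) - (f (zero_tuple d) :: complex)"
proof -
  \<comment> \<open>For \<open>M = 0\<close> truncated subtraction would make the left side
    \<open>{0}\<close>.\<close>
  have "{0..M - 1} = {..<M}"
    using assms by auto
  hence "cube d (M - 1) = PiE {1..d} (\<lambda>_. {..<M})"
    by (simp add: cube_def)
  thus ?thesis
    using finite_cube[of d "M - 1"] zero_tuple_in_cube[of d "M - 1"] by (simp add: sum_diff1)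
qed

context barnes_setting
begin

text \<open>The full cube telescopes to the vertices scaled by \<open>M\<close>; leaving out the
  origin subtracts the unscaled ones. The values at \<open>0\<close> in the two alternating sums
  cancel, so \<open>L 0\<close> does not matter.\<close>

lemma euler_maclaurin_telescope:
  assumes "M \<ge> 1"
  shows "(\<Sum>n\<in>cube d (M - 1) - {zero_tuple d}.
            alternating_sum {1..d} w (\<lambda>h. euler_maclaurin N s (tuple_dot d n w + h))) =
          (-1) ^ d * (subset_sum_op d (euler_maclaurin N s) (\<lambda>i. of_nat M * w i) -
                      subset_sum_op d (euler_maclaurin N s) w)"
proof -
  have "(\<Sum>n\<in>PiE {1..d} (\<lambda>_. {..<M}).
           alternating_sum {1..d} w (\<lambda>h. euler_maclaurin N s (tuple_dot d n w + h))) =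
        alternating_sum {1..d} (\<lambda>i. of_nat M * w i) (euler_maclaurin N s)"
    using alternating_sum_telescope[where I = "{1..d}" and v = w and g = "euler_maclaurin N s" and x = 0 and M = M]
    by (simp add: tuple_dot_def)
  thus ?thesis
    unfolding sum_cube_minus_zero_tuple[OF assms] subset_sum_op_eq
    by (simp add: algebra_simps flip: power_mult_distrib)
qed

definition pole_factor :: "complex \<Rightarrow> complex" where
  "pole_factor \<alpha> = pochhammer (\<alpha> - of_nat d) d"

text \<open>The truncated zeta series, cleared of poles, minus the vertex terms that may diverge
  with \<open>M\<close>. It is entire in \<open>\<alpha>\<close> for each \<open>M\<close>.\<close>

definition corrected_sum :: "nat \<Rightarrow> nat \<Rightarrow> complex \<Rightarrow> complex" where
  "corrected_sum N M \<alpha> =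
     pole_factor \<alpha> * (\<Sum>n\<in>cube d (M - 1) - {zero_tuple d}. branch_power L (tuple_dot d n w) (- \<alpha>)) -
     (-1) ^ d * subset_sum_op d (euler_maclaurin N (\<alpha> - of_nat d)) (\<lambda>i. of_nat M * w i)"

definition corrected_limit :: "nat \<Rightarrow> complex \<Rightarrow> complex" where
  "corrected_limit N \<alpha> =
     remainder_sum N \<alpha> - (-1) ^ d * subset_sum_op d (euler_maclaurin N (\<alpha> - of_nat d)) w"

lemma corrected_sum_eq:
  assumes "M \<ge> 1"
  shows "corrected_sum N M \<alpha> =
    (\<Sum>n\<in>cube d (M - 1) - {zero_tuple d}. remainder N (\<alpha> - of_nat d) (tuple_dot d n w)) -
    (-1) ^ d * subset_sum_op d (euler_maclaurin N (\<alpha> - of_nat d)) w"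
proof -
  have "(-1) ^ d * dpow (\<alpha> - of_nat d) d x = pole_factor \<alpha> * branch_power L x (- \<alpha>)" for x
    by (simp add: dpow_def pole_factor_def flip: power_mult_distrib mult.assoc)
  thus ?thesis
    unfolding corrected_sum_def remainder_def sum_subtractf euler_maclaurin_telescope[OF assms]
    by (simp add: sum_distrib_left right_diff_distrib)
qed

lemma corrected_sum_uniform_limit:
  assumes "cball \<alpha> r \<subseteq> region N" "r \<ge> 0"
  shows "uniform_limit (cball \<alpha> r) (corrected_sum N) (corrected_limit N) sequentially"
proof -
  have "uniform_limit (cball \<alpha> r)
          (\<lambda>M \<beta>. (\<Sum>n\<in>cube d (M - 1) - {zero_tuple d}. remainder N (\<beta> - of_nat d) (tuple_dot d n w)) -
                  (-1) ^ d * subset_sum_op d (euler_maclaurin N (\<beta> - of_nat d)) w)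
          (corrected_limit N) sequentially"
    unfolding corrected_limit_def [abs_def]
    by (intro uniform_limit_intros remainder_sum_uniform_limit assms)
  thus ?thesis
  proof (rule uniform_limit_cong[THEN iffD2, rotated 2])
    show "\<forall>\<^sub>F M in sequentially. \<forall>\<beta>\<in>cball \<alpha> r. corrected_sum N M \<beta> =
           (\<Sum>n\<in>cube d (M - 1) - {zero_tuple d}. remainder N (\<beta> - of_nat d) (tuple_dot d n w)) -
           (-1) ^ d * subset_sum_op d (euler_maclaurin N (\<beta> - of_nat d)) w"
      using eventually_ge_at_top[of "1::nat"] by eventually_elim (simp add: corrected_sum_eq)
  qed auto
qed

lemma corrected_sum_tendsto:
  assumes "\<alpha> \<in> region N"
  shows "(\<lambda>M. corrected_sum N M \<alpha>) \<longlonglongrightarrow> corrected_limit N \<alpha>"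
  by (rule tendsto_uniform_limitI[OF corrected_sum_uniform_limit[of \<alpha> 0]]) (use assms in auto)

lemma holomorphic_pochhammer: "(\<lambda>\<alpha>. pochhammer (\<alpha> - c) m) holomorphic_on A"
  unfolding pochhammer_prod by (intro holomorphic_intros)

lemma holomorphic_dpow: "(\<lambda>\<alpha>. dpow (\<alpha> - c) m x) holomorphic_on A"
  unfolding dpow_def branch_power_def by (intro holomorphic_intros holomorphic_pochhammer)

lemma corrected_sum_holomorphic: "corrected_sum N M holomorphic_on A"
  unfolding corrected_sum_def [abs_def] pole_factor_def subset_sum_op_def branch_power_def
    euler_maclaurin_def
  by (intro holomorphic_intros holomorphic_pochhammer holomorphic_dpow)

lemma corrected_limit_holomorphic: "corrected_limit N holomorphic_on region N"
proof (rule holomorphic_uniform_sequence[OF open_region corrected_sum_holomorphic])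
  fix \<alpha> assume "\<alpha> \<in> region N"
  then obtain r where "r > 0" "cball \<alpha> r \<subseteq> region N"
    using open_region open_contains_cball by blast
  thus "\<exists>r>0. cball \<alpha> r \<subseteq> region N \<and>
          uniform_limit (cball \<alpha> r) (corrected_sum N) (corrected_limit N) sequentially"
    using corrected_sum_uniform_limit[of \<alpha> r N] by auto
qed

lemma sum_w_in_half_plane:
  assumes "S \<noteq> {}" "S \<subseteq> {1..d}"
  shows "sum w S \<in> half_plane \<theta>"
proof -
  have "(\<Sum>i\<in>S. height \<theta> (w i)) > 0"
    using assms w_mem finite_subset[OF assms(2)] by (intro sum_pos) (auto simp: mem_half_plane_iff)
  thus ?thesis
    by (simp add: mem_half_plane_iff height_sum)
qed

lemma dpow_tendsto_0:
  assumes "x \<in> half_plane \<theta>" "Re s + real m > 0"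
  shows "(\<lambda>M. dpow s m (of_nat M * x)) \<longlonglongrightarrow> 0"
proof (rule Lim_null_comparison)
  define C where "C = norm (pochhammer s m) * exp (arg_bound * \<bar>Im s\<bar>) * norm x powr (- Re s - real m)"
  show "\<forall>\<^sub>F M in sequentially. norm (dpow s m (of_nat M * x)) \<le> C * real M powr (- Re s - real m)"
    using eventually_gt_at_top[of "0::nat"]
  proof eventually_elim
    case (elim M)
    have "of_nat M * x \<in> half_plane \<theta>"
      using elim assms by (simp add: mem_half_plane_iff)
    from norm_dpow_le[OF this, of "real M * norm x" s m] show ?case
      using elim assms half_plane_nonzero[OF assms(1)]
      by (simp add: norm_mult powr_mult C_def mult_ac)
  qed
  have "(\<lambda>M. C * real M powr (- Re s - real m)) \<longlonglongrightarrow> C * 0"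
    using assms by (intro tendsto_intros tendsto_neg_powr filterlim_real_sequentially) auto
  thus "(\<lambda>M. C * real M powr (- Re s - real m)) \<longlonglongrightarrow> 0"
    by simp
qed

lemma euler_maclaurin_tail_tendsto_0:
  assumes "\<And>m. m \<in> A \<Longrightarrow> Re s + real m > 0"
  shows "(\<lambda>M. subset_sum_op d (\<lambda>x. \<Sum>m\<in>A. fps_nth bern m * dpow s m x) (\<lambda>i. of_nat M * w i))
           \<longlonglongrightarrow> 0"
proof -
  have "(\<lambda>M. \<Sum>S | S \<noteq> {} \<and> S \<subseteq> {1..d}. (-1) ^ (d - card S) *
           (\<Sum>m\<in>A. fps_nth bern m * dpow s m (of_nat M * sum w S))) \<longlonglongrightarrow>
        (\<Sum>S | S \<noteq> {} \<and> S \<subseteq> {1..d}. (-1) ^ (d - card S) * (\<Sum>m\<in>A. fps_nth bern m * 0))"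
    by (intro tendsto_intros dpow_tendsto_0 sum_w_in_half_plane assms) auto
  thus ?thesis
    by (simp add: subset_sum_op_def sum_distrib_left)
qed

text \<open>The two corrected sums differ by vertex terms of orders \<open>m > N\<close>. On
  \<open>region N\<close> these have \<open>Re (\<alpha> - d) + m > 0\<close>, so they tend to zero
  as \<open>M\<close> grows.\<close>

lemma corrected_limit_mono_eq:
  assumes "\<alpha> \<in> region N" "N \<le> N'"
  shows "corrected_limit N' \<alpha> = corrected_limit N \<alpha>"
proof -
  let ?s = "\<alpha> - of_nat d"
  have "\<alpha> \<in> region N'"
    using assms by (auto simp: region_def)
  hence "(\<lambda>M. corrected_sum N M \<alpha> - corrected_sum N' M \<alpha>) \<longlonglongrightarrow>
           corrected_limit N \<alpha> - corrected_limit N' \<alpha>"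
    using assms by (intro tendsto_diff corrected_sum_tendsto)
  moreover have "(\<lambda>M. corrected_sum N M \<alpha> - corrected_sum N' M \<alpha>) \<longlonglongrightarrow> (-1) ^ d * 0"
  proof -
    have "{..N'} = {..N} \<union> {N<..N'}"
      using assms by auto
    hence "(\<Sum>m\<le>N'. f m) = (\<Sum>m\<le>N. f m) + (\<Sum>m\<in>{N<..N'}. f m)" for f :: "nat \<Rightarrow> complex"
      by (simp only:) (rule sum.union_disjoint, auto)
    hence "euler_maclaurin N' ?s x - euler_maclaurin N ?s x =
             (\<Sum>m\<in>{N<..N'}. fps_nth bern m * dpow ?s m x)" for x
      by (simp add: euler_maclaurin_def)
    hence "corrected_sum N M \<alpha> - corrected_sum N' M \<alpha> = (-1) ^ d *
        subset_sum_op d (\<lambda>x. \<Sum>m\<in>{N<..N'}. fps_nth bern m * dpow ?s m x) (\<lambda>i. of_nat M * w i)" for M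
      by (simp add: corrected_sum_def subset_sum_op_def algebra_simps sum.distrib)
    moreover have "Re ?s + real m > 0" if "m \<in> {N<..N'}" for m
    proof -
      have "real m \<ge> real N + 1"
        using that by auto
      thus ?thesis
        using assms by (simp add: region_def)
    qed
    ultimately show ?thesis
      using euler_maclaurin_tail_tendsto_0[of "{N<..N'}" ?s] by (simp only: tendsto_mult_left)
  qed
  ultimately show ?thesis
    using LIMSEQ_unique by fastforce
qed

lemma corrected_limit_eq_barnes_series:
  assumes "Re \<alpha> > real d"
  shows "corrected_limit N \<alpha> = pole_factor \<alpha> * barnes_series L d w \<alpha>"
proof (rule LIMSEQ_unique)
  show "(\<lambda>M. corrected_sum N M \<alpha>) \<longlonglongrightarrow> corrected_limit N \<alpha>"
    using assms by (intro corrected_sum_tendsto) (simp add: region_def)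
  have "(\<lambda>M. subset_sum_op d (euler_maclaurin N (\<alpha> - of_nat d)) (\<lambda>i. of_nat M * w i)) \<longlonglongrightarrow> 0"
    using euler_maclaurin_tail_tendsto_0[of "{..N}" "\<alpha> - of_nat d"] assms
    unfolding euler_maclaurin_def [abs_def] by fastforce
  hence "(\<lambda>M. corrected_sum N M \<alpha>) \<longlonglongrightarrow>
          pole_factor \<alpha> * barnes_series L d w \<alpha> - (-1) ^ d * 0"
    unfolding corrected_sum_def by (intro tendsto_intros barnes_series_limit assms)
  thus "(\<lambda>M. corrected_sum N M \<alpha>) \<longlonglongrightarrow> pole_factor \<alpha> * barnes_series L d w \<alpha>"
    by simp
qed

text \<open>The local limits glued to one entire function; the index is large enough for
  \<open>\<alpha>\<close> to lie in its region.\<close>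

definition barnes_numerator :: "complex \<Rightarrow> complex" where
  "barnes_numerator \<alpha> = corrected_limit (nat \<lceil>real d - Re \<alpha>\<rceil>) \<alpha>"

lemma barnes_numerator_eq:
  assumes "\<alpha> \<in> region N"
  shows "barnes_numerator \<alpha> = corrected_limit N \<alpha>"
proof -
  have "\<alpha> \<in> region (nat \<lceil>real d - Re \<alpha>\<rceil>)"
    unfolding region_def by simp linarith
  thus ?thesis
    unfolding barnes_numerator_def using corrected_limit_mono_eq assms by (metis nle_le)
qed

lemma barnes_numerator_holomorphic: "barnes_numerator holomorphic_on UNIV"
proof -
  have "barnes_numerator holomorphic_on (\<Union>N. region N)"
  proof (rule holomorphic_on_UN_open)
    fix N
    show "barnes_numerator holomorphic_on region N"
      by (rule holomorphic_transform[OF corrected_limit_holomorphic[of N]]) (simp add: barnes_numerator_eq)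
  qed (rule open_region)
  moreover have "\<alpha> \<in> (\<Union>N. region N)" for \<alpha>
    unfolding region_def
    by (intro UN_I[of "nat \<lceil>real d - Re \<alpha>\<rceil>"]) (simp, simp, linarith)
  ultimately show ?thesis
    by (metis UNIV_eq_I)
qed

lemma pole_factor_eq_0_iff: "pole_factor \<alpha> = 0 \<longleftrightarrow> (\<exists>j\<in>{1..d}. \<alpha> = of_nat j)"
proof -
  have "(\<exists>k<d. \<alpha> - of_nat d = - of_nat k) \<longleftrightarrow> (\<exists>j\<in>{1..d}. \<alpha> = of_nat j)"
  proof
    assume "\<exists>k<d. \<alpha> - of_nat d = - of_nat k"
    then obtain k where "k < d" "\<alpha> = of_nat (d - k)"
      by (auto simp: algebra_simps of_nat_diff)
    thus "\<exists>j\<in>{1..d}. \<alpha> = of_nat j"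
      by (intro bexI[of _ "d - k"]) auto
  next
    assume "\<exists>j\<in>{1..d}. \<alpha> = of_nat j"
    then obtain j where "j \<in> {1..d}" "\<alpha> = of_nat j"
      by auto
    thus "\<exists>k<d. \<alpha> - of_nat d = - of_nat k"
      by (intro exI[of _ "d - j"]) (auto simp: of_nat_diff)
  qed
  thus ?thesis
    by (simp add: pole_factor_def pochhammer_eq_0_iff)
qed

text \<open>The quotient agrees with the series for \<open>Re \<alpha> > d\<close>, where
  \<open>pole_factor\<close> has no zero; uniqueness of the continuation does the rest.\<close>

lemma barnes_zeta_eq: "barnes_zeta L d w = remove_sings (\<lambda>\<alpha>. barnes_numerator \<alpha> / pole_factor \<alpha>)"
proof -
  let ?f = "\<lambda>\<alpha>. barnes_numerator \<alpha> / pole_factor \<alpha>"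
  have hol: "pole_factor holomorphic_on UNIV"
    unfolding pole_factor_def [abs_def] by (rule holomorphic_pochhammer)
  have "?f meromorphic_on UNIV"
    using hol barnes_numerator_holomorphic
    by (intro meromorphic_intros analytic_on_imp_meromorphic_on) (simp_all add: analytic_on_open)
  hence nice: "remove_sings ?f nicely_meromorphic_on UNIV"
    by (rule remove_sings_nicely_meromorphic)
  have eq: "remove_sings ?f \<alpha> = barnes_series L d w \<alpha>" if \<alpha>: "Re \<alpha> > real d" for \<alpha>
  proof -
    have nz: "pole_factor \<alpha> \<noteq> 0"
      using \<alpha> by (auto simp: pole_factor_eq_0_iff)
    have "?f analytic_on {\<alpha>}"
      using nz hol barnes_numerator_holomorphic
      by (intro analytic_on_divide) (auto simp: analytic_on_open intro: analytic_on_subset[of _ UNIV])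
    hence "remove_sings ?f \<alpha> = ?f \<alpha>"
      by (rule remove_sings_at_analytic)
    also have "\<alpha> \<in> region 0"
      using \<alpha> by (simp add: region_def)
    hence "?f \<alpha> = barnes_series L d w \<alpha>"
      using nz by (simp add: barnes_numerator_eq corrected_limit_eq_barnes_series[OF \<alpha>])
    finally show ?thesis .
  qed
  show ?thesis
    unfolding barnes_zeta_def
    by (rule the_equality) (use nice eq barnes_continuation_unique in blast)+
qed

end

subsection \<open>The finite part\<close>

lemma pochhammer_eq_prod_roots:
  fixes x :: "'a::comm_ring_1"
  assumes "m \<le> d"
  shows "pochhammer (x - of_nat d) m = (\<Prod>j\<in>{d - m<..d}. x - of_nat j)"
proof -
  have "pochhammer (x - of_nat d) m = (\<Prod>i\<in>{0..<m}. x - of_nat d + of_nat i)"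
    by (rule pochhammer_prod)
  also have "\<dots> = (\<Prod>j\<in>{d - m<..d}. x - of_nat j)"
    by (rule prod.reindex_bij_witness[of _ "\<lambda>j. d - j" "\<lambda>i. d - i"])
       (use assms in \<open>auto simp: of_nat_diff\<close>)
  finally show ?thesis .
qed

text \<open>The roots below \<open>q\<close> contribute \<open>(q - 1)!\<close>, the
  \<open>k\<close> roots above it \<open>(-1)^k k!\<close>.\<close>

lemma prod_diff_roots_eq_fact:
  assumes "q \<ge> 1"
  shows "(\<Prod>j\<in>{1..q + k} - {q}. of_nat q - of_nat j :: complex) = (-1) ^ k * fact (q - 1) * fact k"
proof (induction k)
  case 0
  have "(\<Prod>j\<in>{1..q} - {q}. of_nat q - of_nat j :: complex) = (\<Prod>i\<in>{1..q - 1}. of_nat i)"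
    by (rule prod.reindex_bij_witness[of _ "\<lambda>i. q - i" "\<lambda>i. q - i"]) (auto simp: of_nat_diff)
  thus ?case
    by (simp add: fact_prod)
next
  case (Suc k)
  have "{1..q + Suc k} - {q} = insert (q + Suc k) ({1..q + k} - {q})"
    by auto
  hence "(\<Prod>j\<in>{1..q + Suc k} - {q}. of_nat q - of_nat j :: complex) =
           (of_nat q - of_nat (q + Suc k)) * (\<Prod>j\<in>{1..q + k} - {q}. of_nat q - of_nat j)"
    by (simp only:) (rule prod.insert, auto)
  thus ?case
    unfolding Suc by (simp add: algebra_simps)
qed

lemma sum_inverse_diff_eq_harm:
  "(\<Sum>j\<in>{1..<q}. 1 / (of_nat q - of_nat j :: complex)) = harm (q - 1)"
  unfolding harm_def
  by (rule sum.reindex_bij_witness[of _ "\<lambda>i. q - i" "\<lambda>i. q - i"]) (auto simp: of_nat_diff field_simps)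

text \<open>Division by \<open>z - q\<close> moves the linear Taylor coefficient of \<open>h\<close>
  to the constant term.\<close>

lemma finite_part_simple_pole:
  assumes "h analytic_on {q}" "\<forall>\<^sub>F z in at q. f z = h z / (z - q)"
  shows "finite_part (remove_sings f) q = deriv h q"
proof -
  have "(\<lambda>z. h (q + z)) has_laurent_expansion fps_to_fls (fps_expansion h q)"
    using analytic_at_imp_has_fps_expansion[OF assms(1)] by (rule has_laurent_expansion_fps)
  hence "(\<lambda>z. h (q + z) / z) has_laurent_expansion fps_to_fls (fps_expansion h q) / fls_X"
    by (intro laurent_expansion_intros)
  moreover have "\<forall>\<^sub>F z in at 0. f (q + z) = h (q + z) / z"
    using assms(2) by (subst (asm) at_to_0) (simp add: eventually_filtermap add.commute)
  ultimately have f: "(\<lambda>z. f (q + z)) has_laurent_expansion fps_to_fls (fps_expansion h q) / fls_X"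
    by (subst has_laurent_expansion_cong) auto
  have "laurent_expansion (remove_sings f) q = laurent_expansion f q"
    by (intro laurent_expansion_cong eventually_remove_sings_eq_at has_laurent_expansion_isolated[OF f] refl)
  also have "\<dots> = fps_to_fls (fps_expansion h q) / fls_X"
    using f by (rule laurent_expansion_eqI)
  finally have "laurent_expansion (remove_sings f) q = fps_to_fls (fps_expansion h q) / fls_X" .
  thus ?thesis
    by (simp add: finite_part_def fps_expansion_def fls_divide_X)
qed

context barnes_setting
begin

text \<open>For \<open>m = 0\<close> this is the pole factor without its zero at \<open>q\<close>; for \<open>m \<le> d - q\<close> the \<open>m\<close> largest
  zeros have been cancelled against \<open>pochhammer (\<alpha> - d) m\<close>.\<close>

definition cofactor :: "nat \<Rightarrow> nat \<Rightarrow> complex \<Rightarrow> complex" where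
  "cofactor q m \<alpha> = (\<Prod>j\<in>{1..d - m} - {q}. \<alpha> - of_nat j)"

lemma cofactor_nonzero:
  assumes "\<alpha> \<in> ball (of_nat q) 1"
  shows "cofactor q m \<alpha> \<noteq> 0"
proof -
  have "\<alpha> \<noteq> of_nat j" if "j \<noteq> q" for j
  proof
    assume "\<alpha> = of_nat j"
    hence "norm (of_real (real q - real j) :: complex) < 1"
      using assms by (simp add: dist_norm)
    hence "\<bar>real q - real j\<bar> < 1"
      by (simp only: norm_of_real)
    thus False
      using that by linarith
  qed
  thus ?thesis
    by (auto simp: cofactor_def)
qed

lemma holomorphic_cofactor: "cofactor q m holomorphic_on A"
  unfolding cofactor_def [abs_def] by (intro holomorphic_intros)

lemma pole_factor_eq_cofactor:
  assumes "q \<in> {1..d}"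
  shows "pole_factor \<alpha> = (\<alpha> - of_nat q) * cofactor q 0 \<alpha>"
proof -
  have "pole_factor \<alpha> = (\<Prod>j\<in>{1..d}. \<alpha> - of_nat j)"
    unfolding pole_factor_def by (subst pochhammer_eq_prod_roots) (auto intro: prod.cong)
  also have "\<dots> = (\<alpha> - of_nat q) * cofactor q 0 \<alpha>"
    unfolding cofactor_def using assms by (subst prod.remove[of _ q]) auto
  finally show ?thesis .
qed

text \<open>The factors of the Pochhammer symbol have the roots \<open>d - m + 1, ..., d\<close>,
  which all exceed \<open>q\<close> and therefore occur in \<open>cofactor q 0\<close>.\<close>

lemma pochhammer_div_cofactor:
  assumes "m \<le> d - q" "\<alpha> \<in> ball (of_nat q) 1"
  shows "pochhammer (\<alpha> - of_nat d) m / cofactor q 0 \<alpha> = 1 / cofactor q m \<alpha>"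
proof -
  have "{1..d} - {q} = {d - m<..d} \<union> ({1..d - m} - {q})"
    using assms(1) by auto
  hence "cofactor q 0 \<alpha> = (\<Prod>j\<in>{d - m<..d} \<union> ({1..d - m} - {q}). \<alpha> - of_nat j)"
    by (simp only: cofactor_def diff_zero)
  also have "\<dots> = (\<Prod>j\<in>{d - m<..d}. \<alpha> - of_nat j) * cofactor q m \<alpha>"
    unfolding cofactor_def by (rule prod.union_disjoint) auto
  also have "(\<Prod>j\<in>{d - m<..d}. \<alpha> - of_nat j) = pochhammer (\<alpha> - of_nat d) m"
    by (rule pochhammer_eq_prod_roots[symmetric]) (use assms(1) in linarith)
  finally have "cofactor q 0 \<alpha> = pochhammer (\<alpha> - of_nat d) m * cofactor q m \<alpha>" .
  thus ?thesis
    using cofactor_nonzero[OF assms(2), of 0] by auto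
qed

lemma barnes_zeta_finite_part:
  assumes "q \<in> {1..d}"
  shows "finite_part (barnes_zeta L d w) (of_nat q) =
           deriv (\<lambda>\<alpha>. barnes_numerator \<alpha> / cofactor q 0 \<alpha>) (of_nat q)"
  unfolding barnes_zeta_eq
proof (rule finite_part_simple_pole)
  show "(\<lambda>\<alpha>. barnes_numerator \<alpha> / cofactor q 0 \<alpha>) analytic_on {of_nat q}"
    using cofactor_nonzero[of "of_nat q" q 0] barnes_numerator_holomorphic
      holomorphic_cofactor[of q 0 UNIV]
    by (intro analytic_on_divide) (auto simp: analytic_on_open intro: analytic_on_subset[of _ UNIV])
  show "\<forall>\<^sub>F \<alpha> in at (of_nat q). barnes_numerator \<alpha> / pole_factor \<alpha> =
          barnes_numerator \<alpha> / cofactor q 0 \<alpha> / (\<alpha> - of_nat q)"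
    by (simp add: pole_factor_eq_cofactor[OF assms] mult.commute)
qed

lemma nat_mem_region: "q \<in> {1..d} \<Longrightarrow> of_nat q \<in> region (d - q)"
  by (auto simp: region_def of_nat_diff)

text \<open>Locally uniform convergence of holomorphic functions carries over to derivatives. The
  order \<open>d - q\<close> is the least one whose region contains \<open>q\<close>.\<close>

lemma deriv_corrected_sum_tendsto:
  assumes "q \<in> {1..d}"
  shows "(\<lambda>M. deriv (\<lambda>\<alpha>. corrected_sum (d - q) M \<alpha> / cofactor q 0 \<alpha>) (of_nat q))
           \<longlonglongrightarrow> finite_part (barnes_zeta L d w) (of_nat q)"
proof -
  let ?q = "of_nat q :: complex" and ?N = "d - q"
  obtain r where r: "r > 0" "cball ?q r \<subseteq> region ?N"
    using nat_mem_region[OF assms] open_region open_contains_cball by blast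
  have deriv_limit: "(\<lambda>M. deriv (corrected_sum ?N M) ?q) \<longlonglongrightarrow> deriv (corrected_limit ?N) ?q"
  proof (rule deriv_complex_uniform_limit)
    show "uniform_limit (ball ?q r) (corrected_sum ?N) (corrected_limit ?N) sequentially"
      by (rule uniform_limit_on_subset[OF corrected_sum_uniform_limit[OF r(2)]]) (use r(1) in auto)
  qed (use r corrected_sum_holomorphic in auto)
  have Q: "cofactor q 0 ?q \<noteq> 0"
    by (rule cofactor_nonzero) simp
  have dQ: "(cofactor q 0 has_field_derivative deriv (cofactor q 0) ?q) (at ?q)"
    by (rule holomorphic_derivI[OF holomorphic_cofactor open_UNIV]) simp
  \<comment> \<open>The derivative of the quotient involves \<open>f\<close> only through its value
    and derivative at \<open>q\<close>, and both converge.\<close>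
  have quotient: "deriv (\<lambda>\<alpha>. f \<alpha> / cofactor q 0 \<alpha>) ?q =
      (deriv f ?q * cofactor q 0 ?q - f ?q * deriv (cofactor q 0) ?q) / (cofactor q 0 ?q * cofactor q 0 ?q)"
    if "f holomorphic_on ball ?q r" for f
  proof -
    have "(f has_field_derivative deriv f ?q) (at ?q)"
      using that r by (intro holomorphic_derivI[of f "ball ?q r"]) auto
    from DERIV_divide[OF this dQ Q] show ?thesis
      by (rule DERIV_imp_deriv)
  qed
  have eq: "\<forall>\<^sub>F \<alpha> in nhds ?q. corrected_limit ?N \<alpha> = barnes_numerator \<alpha>"
    using eventually_nhds_in_open[OF open_region nat_mem_region[OF assms]]
    by eventually_elim (simp add: barnes_numerator_eq)
  have "(\<lambda>M. deriv (\<lambda>\<alpha>. corrected_sum ?N M \<alpha> / cofactor q 0 \<alpha>) ?q) \<longlonglongrightarrow>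
          (deriv (corrected_limit ?N) ?q * cofactor q 0 ?q -
           corrected_limit ?N ?q * deriv (cofactor q 0) ?q) / (cofactor q 0 ?q * cofactor q 0 ?q)"
    unfolding quotient[OF corrected_sum_holomorphic]
    by (intro tendsto_intros deriv_limit corrected_sum_tendsto nat_mem_region assms) (use Q in auto)
  moreover have "deriv (\<lambda>\<alpha>. corrected_limit ?N \<alpha> / cofactor q 0 \<alpha>) ?q =
          (deriv (corrected_limit ?N) ?q * cofactor q 0 ?q -
           corrected_limit ?N ?q * deriv (cofactor q 0) ?q) / (cofactor q 0 ?q * cofactor q 0 ?q)"
    by (rule quotient, rule holomorphic_on_subset[OF corrected_limit_holomorphic]) (use r in auto)
  moreover have "deriv (\<lambda>\<alpha>. corrected_limit ?N \<alpha> / cofactor q 0 \<alpha>) ?q =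
                 deriv (\<lambda>\<alpha>. barnes_numerator \<alpha> / cofactor q 0 \<alpha>) ?q"
    by (rule deriv_cong_ev) (use eq in \<open>auto elim: eventually_mono\<close>)
  ultimately show ?thesis
    by (simp only: barnes_zeta_finite_part[OF assms])
qed

section \<open>Explicit evaluation of the derivatives at \<open>q\<close>\<close>

lemma subset_sum_op_power:
  assumes "k < d"
  shows "subset_sum_op d (\<lambda>x. x ^ k) w = (if k = 0 then - ((-1) ^ d) else 0)"
  \<comment> \<open>The full alternating sum vanishes, so only the missing term \<open>0 ^ k\<close>
    of the empty set counts; it is \<open>1\<close> for \<open>k = 0\<close>.\<close>
  using alternating_sum_power_eq_0[of "{1..d}" k w] assms by (simp add: subset_sum_op_eq)

lemma cofactor_at:
  assumes "q \<in> {1..d}" "m \<le> d - q"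
  shows "cofactor q m (of_nat q) = (-1) ^ (d - q - m) * fact (q - 1) * fact (d - q - m)"
proof -
  have "q + (d - q - m) = d - m" "q \<ge> 1"
    using assms by auto
  thus ?thesis
    using prod_diff_roots_eq_fact[of q "d - q - m"] by (simp only: cofactor_def)
qed

text \<open>This is the source of the harmonic number: the logarithmic derivative of
  \<open>prod_{j<q} (\<alpha> - j)\<close> at \<open>q\<close> is the sum of
  \<open>1 / (q - j)\<close>.\<close>

lemma deriv_inverse_cofactor:
  assumes "q \<in> {1..d}"
  shows "deriv (\<lambda>\<alpha>. 1 / cofactor q (d - q) \<alpha>) (of_nat q) = - harm (q - 1) / fact (q - 1)"
proof -
  let ?q = "of_nat q :: complex"
  have "{1..d - (d - q)} - {q} = {1..<q}"
    using assms by auto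
  hence c: "cofactor q (d - q) = (\<lambda>\<alpha>. \<Prod>j\<in>{1..<q}. \<alpha> - of_nat j)"
    by (simp add: cofactor_def fun_eq_iff)
  have v: "cofactor q (d - q) ?q = fact (q - 1)"
    using cofactor_at[OF assms, of "d - q"] by simp
  have "(cofactor q (d - q) has_field_derivative
          (\<Prod>j\<in>{1..<q}. ?q - of_nat j) * (\<Sum>j\<in>{1..<q}. 1 / (?q - of_nat j))) (at ?q)"
    unfolding c by (rule has_field_derivative_prod') (auto intro!: derivative_eq_intros)
  hence "(cofactor q (d - q) has_field_derivative fact (q - 1) * harm (q - 1)) (at ?q)"
    using v by (simp only: sum_inverse_diff_eq_harm c)
  hence "((\<lambda>\<alpha>. 1 / cofactor q (d - q) \<alpha>) has_field_derivative - harm (q - 1) / fact (q - 1)) (at ?q)"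
    by (auto intro!: derivative_eq_intros simp: v)
  thus ?thesis
    by (rule DERIV_imp_deriv)
qed

lemma branch_power_of_nat: "x \<in> half_plane \<theta> \<Longrightarrow> branch_power L x (of_nat k) = x ^ k"
  by (simp add: branch_power_def exp_of_nat_mult exp_L)

text \<open>After cancellation the quotient is
  \<open>(-1)^m x^(d - m - \<alpha>) / cofactor q m \<alpha>\<close>. Differentiating the power in
  \<open>\<alpha>\<close> produces the logarithm of \<open>x\<close>.\<close>

lemma dpow_div_cofactor_deriv:
  assumes "q \<in> {1..d}" "m \<le> d - q" "x \<in> half_plane \<theta>"
  shows "((\<lambda>\<alpha>. dpow (\<alpha> - of_nat d) m x / cofactor q 0 \<alpha>) has_field_derivative
           (-1) ^ m * (deriv (\<lambda>\<alpha>. 1 / cofactor q m \<alpha>) (of_nat q) - L x / cofactor q m (of_nat q)) *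
             x ^ (d - q - m)) (at (of_nat q))"
proof -
  let ?q = "of_nat q :: complex"
  define g where "g = (\<lambda>\<alpha>. 1 / cofactor q m \<alpha>)"
  let ?f = "\<lambda>\<alpha>. (-1) ^ m * g \<alpha> * branch_power L x (of_nat d - of_nat m - \<alpha>)"
  have "g holomorphic_on ball ?q 1"
    unfolding g_def using cofactor_nonzero by (intro holomorphic_intros holomorphic_cofactor) auto
  hence "(g has_field_derivative deriv g ?q) (at ?q)"
    by (rule holomorphic_derivI) auto
  hence "(?f has_field_derivative
           (-1) ^ m * (deriv g ?q * exp ((of_nat d - of_nat m - ?q) * L x) -
             g ?q * (L x * exp ((of_nat d - of_nat m - ?q) * L x)))) (at ?q)"
    unfolding branch_power_def by (auto intro!: derivative_eq_intros simp: algebra_simps)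
  moreover have "q + m \<le> d"
    using assms by auto
  hence "of_nat d - of_nat m - ?q = of_nat (d - q - m)"
    by (simp add: of_nat_diff algebra_simps)
  hence "exp ((of_nat d - of_nat m - ?q) * L x) = x ^ (d - q - m)"
    using branch_power_of_nat[OF assms(3), of "d - q - m"] by (simp only: branch_power_def)
  ultimately have "(?f has_field_derivative
           (-1) ^ m * (deriv (\<lambda>\<alpha>. 1 / cofactor q m \<alpha>) ?q - L x / cofactor q m ?q) *
             x ^ (d - q - m)) (at ?q)"
    by (simp add: g_def algebra_simps)
  thus ?thesis
  proof (rule has_field_derivative_transform_within_open[OF _ open_ball])
    fix \<alpha> assume \<alpha>: "\<alpha> \<in> ball ?q 1"
    have "dpow (\<alpha> - of_nat d) m x / cofactor q 0 \<alpha> =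
            (-1) ^ m * (pochhammer (\<alpha> - of_nat d) m / cofactor q 0 \<alpha>) *
              branch_power L x (of_nat d - of_nat m - \<alpha>)"
      by (simp add: dpow_def algebra_simps)
    thus "?f \<alpha> = dpow (\<alpha> - of_nat d) m x / cofactor q 0 \<alpha>"
      by (simp only: pochhammer_div_cofactor[OF assms(2) \<alpha>] g_def)
  qed auto
qed

lemma deriv_corrected_sum:
  assumes q: "q \<in> {1..d}" and M: "M \<ge> 1"
  shows "deriv (\<lambda>\<alpha>. corrected_sum (d - q) M \<alpha> / cofactor q 0 \<alpha>) (of_nat q) =
    (\<Sum>n\<in>cube d (M - 1) - {zero_tuple d}. branch_power L (tuple_dot d n w) (- of_nat q)) -
    (-1) ^ d * (\<Sum>m\<le>d - q. fps_nth bern m * (-1) ^ m *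
      subset_sum_op d (\<lambda>x. (deriv (\<lambda>\<alpha>. 1 / cofactor q m \<alpha>) (of_nat q) -
        L (of_nat M * x) / cofactor q m (of_nat q)) * (of_nat M * x) ^ (d - q - m)) w)"
proof -
  let ?q = "of_nat q :: complex" and ?Q = "cofactor q 0" and ?A = "cube d (M - 1) - {zero_tuple d}"
  let ?S = "{S. S \<noteq> {} \<and> S \<subseteq> {1..d}}"
  define y where "y = (\<lambda>S. of_nat M * sum w S)"
  define D where "D = (\<lambda>m x. (-1) ^ m * (deriv (\<lambda>\<alpha>. 1 / cofactor q m \<alpha>) ?q -
                          L x / cofactor q m ?q) * x ^ (d - q - m))"
  have y: "y S \<in> half_plane \<theta>" if "S \<in> ?S" for S
    using sum_w_in_half_plane[of S] that M by (simp add: y_def mem_half_plane_iff)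
  \<comment> \<open>The factor \<open>\<alpha> - q\<close> vanishes at \<open>q\<close>, so the
    product rule leaves just the value of the sum.\<close>
  have "((\<lambda>\<alpha>. (\<alpha> - ?q) * (\<Sum>n\<in>?A. branch_power L (tuple_dot d n w) (- \<alpha>))) has_field_derivative
          (\<Sum>n\<in>?A. branch_power L (tuple_dot d n w) (- ?q))) (at ?q)"
    unfolding branch_power_def by (auto intro!: derivative_eq_intros)
  moreover have "((\<lambda>\<alpha>. (-1) ^ d * (\<Sum>S\<in>?S. (-1) ^ (d - card S) *
            (\<Sum>m\<le>d - q. fps_nth bern m * (dpow (\<alpha> - of_nat d) m (y S) / ?Q \<alpha>)))) has_field_derivative
          (-1) ^ d * (\<Sum>S\<in>?S. (-1) ^ (d - card S) * (\<Sum>m\<le>d - q. fps_nth bern m * D m (y S)))) (at ?q)"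
    unfolding D_def
    by (intro DERIV_cmult DERIV_sum dpow_div_cofactor_deriv q y) auto
  ultimately have "((\<lambda>\<alpha>. (\<alpha> - ?q) * (\<Sum>n\<in>?A. branch_power L (tuple_dot d n w) (- \<alpha>)) -
        (-1) ^ d * (\<Sum>S\<in>?S. (-1) ^ (d - card S) *
          (\<Sum>m\<le>d - q. fps_nth bern m * (dpow (\<alpha> - of_nat d) m (y S) / ?Q \<alpha>)))) has_field_derivative
      (\<Sum>n\<in>?A. branch_power L (tuple_dot d n w) (- ?q)) -
        (-1) ^ d * (\<Sum>S\<in>?S. (-1) ^ (d - card S) * (\<Sum>m\<le>d - q. fps_nth bern m * D m (y S)))) (at ?q)"
    by (rule DERIV_diff)
  hence "((\<lambda>\<alpha>. corrected_sum (d - q) M \<alpha> / ?Q \<alpha>) has_field_derivative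
      (\<Sum>n\<in>?A. branch_power L (tuple_dot d n w) (- ?q)) -
        (-1) ^ d * (\<Sum>S\<in>?S. (-1) ^ (d - card S) * (\<Sum>m\<le>d - q. fps_nth bern m * D m (y S)))) (at ?q)"
  proof (rule has_field_derivative_transform_within_open[OF _ open_ball])
    fix \<alpha> :: complex assume "\<alpha> \<in> ball ?q 1"
    hence "?Q \<alpha> \<noteq> 0"
      by (rule cofactor_nonzero)
    moreover have "(\<Sum>S\<in>?S. (-1) ^ (d - card S) *
          (\<Sum>m\<le>d - q. fps_nth bern m * (dpow (\<alpha> - of_nat d) m (y S) / ?Q \<alpha>))) =
        (\<Sum>S\<in>?S. (-1) ^ (d - card S) * (\<Sum>m\<le>d - q. fps_nth bern m * dpow (\<alpha> - of_nat d) m (y S))) / ?Q \<alpha>"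
      by (simp only: times_divide_eq_right sum_divide_distrib[symmetric])
    ultimately show "(\<alpha> - ?q) * (\<Sum>n\<in>?A. branch_power L (tuple_dot d n w) (- \<alpha>)) -
        (-1) ^ d * (\<Sum>S\<in>?S. (-1) ^ (d - card S) *
          (\<Sum>m\<le>d - q. fps_nth bern m * (dpow (\<alpha> - of_nat d) m (y S) / ?Q \<alpha>))) =
        corrected_sum (d - q) M \<alpha> / ?Q \<alpha>"
      by (simp add: corrected_sum_def pole_factor_eq_cofactor[OF q] subset_sum_op_def y_def
          euler_maclaurin_def diff_divide_distrib flip: sum_distrib_left)
  qed auto
  hence "deriv (\<lambda>\<alpha>. corrected_sum (d - q) M \<alpha> / ?Q \<alpha>) ?q =
      (\<Sum>n\<in>?A. branch_power L (tuple_dot d n w) (- ?q)) -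
        (-1) ^ d * (\<Sum>S\<in>?S. (-1) ^ (d - card S) * (\<Sum>m\<le>d - q. fps_nth bern m * D m (y S)))"
    by (rule DERIV_imp_deriv)
  also have "(\<Sum>S\<in>?S. (-1) ^ (d - card S) * (\<Sum>m\<le>d - q. fps_nth bern m * D m (y S))) =
      (\<Sum>m\<le>d - q. fps_nth bern m * (-1) ^ m *
        subset_sum_op d (\<lambda>x. (deriv (\<lambda>\<alpha>. 1 / cofactor q m \<alpha>) ?q -
          L (of_nat M * x) / cofactor q m ?q) * (of_nat M * x) ^ (d - q - m)) w)"
    unfolding subset_sum_op_def sum_distrib_left
    by (subst sum.swap) (simp add: D_def y_def sum_distrib_left mult_ac)
  finally show ?thesis .
qed

text \<open>By \<open>L_scale\<close> the logarithm of \<open>M\<close> separates from that of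
  \<open>x\<close>. It and \<open>a\<close> then multiply pure powers of \<open>x\<close>, which the
  subset sum kills unless the exponent is \<open>0\<close>, that is,
  \<open>m = d - q\<close>.\<close>

lemma scaled_subset_sum:
  assumes q: "q \<in> {1..d}" and m: "m \<le> d - q" and M: "M \<ge> 1"
  shows "subset_sum_op d (\<lambda>x. (a - L (of_nat M * x) / b) * (of_nat M * x) ^ (d - q - m)) w =
    (if m = d - q then (-1) ^ d * (of_real (ln (real M)) / b - a) else 0) -
    of_nat M ^ (d - q - m) * subset_sum_op d (\<lambda>x. x ^ (d - q - m) * L x) w / b"
proof -
  let ?k = "d - q - m" and ?S = "{S. S \<noteq> {} \<and> S \<subseteq> {1..d}}"
  define c where "c = (a - of_real (ln (real M)) / b) * of_nat M ^ ?k"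
  have "(a - L (of_nat M * x) / b) * (of_nat M * x) ^ ?k =
          c * x ^ ?k - of_nat M ^ ?k / b * (x ^ ?k * L x)" if "x \<in> half_plane \<theta>" for x
    using L_scale[OF that, of "real M"] M
    by (simp add: c_def power_mult_distrib add_divide_distrib ring_distribs algebra_simps)
  hence "subset_sum_op d (\<lambda>x. (a - L (of_nat M * x) / b) * (of_nat M * x) ^ ?k) w =
           (\<Sum>S\<in>?S. (-1) ^ (d - card S) *
              (c * sum w S ^ ?k - of_nat M ^ ?k / b * (sum w S ^ ?k * L (sum w S))))"
    unfolding subset_sum_op_def by (intro sum.cong) (auto simp: sum_w_in_half_plane)
  also have "\<dots> = c * subset_sum_op d (\<lambda>x. x ^ ?k) w -
                 of_nat M ^ ?k / b * subset_sum_op d (\<lambda>x. x ^ ?k * L x) w"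
    unfolding subset_sum_op_def sum_distrib_left sum_subtractf[symmetric]
    by (simp add: algebra_simps)
  also have "c * subset_sum_op d (\<lambda>x. x ^ ?k) w =
               (if m = d - q then (-1) ^ d * (of_real (ln (real M)) / b - a) else 0)"
  proof -
    have "?k < d"
      using q by auto
    hence "subset_sum_op d (\<lambda>x. x ^ ?k) w = (if m = d - q then - ((-1) ^ d) else 0)"
      using m by (subst subset_sum_op_power) auto
    thus ?thesis
      by (auto simp: c_def algebra_simps)
  qed
  finally show ?thesis
    by simp
qed

lemma deriv_corrected_sum_explicit:
  assumes q: "q \<in> {1..d}" and M: "M \<ge> 1"
  shows "deriv (\<lambda>\<alpha>. corrected_sum (d - q) M \<alpha> / cofactor q 0 \<alpha>) (of_nat q) =
            (-1) ^ q / fact (q - 1) *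
              (\<Sum>m=0..d-q. bernoullian_deriv_0 d w m / (fact m * fact (d - q - m)) *
                 subset_sum_op d (\<lambda>x. x ^ (d - q - m) * L x) w * of_nat M ^ (d - q - m))
            + bernoullian_deriv_0 d w (d - q) * (-1) ^ (d + q + 1) / (fact (q - 1) * fact (d - q)) *
                of_real (ln (real M))
            + (\<Sum>n\<in>cube d (M - 1) - {zero_tuple d}. branch_power L (tuple_dot d n w) (- of_nat q))
            + bernoullian_deriv_0 d w (d - q) * (-1) ^ (d + q + 1) / (fact (q - 1) * fact (d - q)) *
                  harm (q - 1)"
proof -
  let ?q = "of_nat q :: complex"
  define F where "F = (\<lambda>k. subset_sum_op d (\<lambda>x. x ^ k * L x) w)"
  define a where "a = (\<lambda>m. deriv (\<lambda>\<alpha>. 1 / cofactor q m \<alpha>) ?q)"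
  \<comment> \<open>The logarithm of \<open>M\<close> and the harmonic number both come from the
    term \<open>m = d - q\<close>, hence share a coefficient.\<close>
  define H :: complex where "H = (of_real (ln (real M)) + harm (q - 1)) / fact (q - 1)"
  \<comment> \<open>The signs come from \<open>corrected_sum\<close>, from \<open>dpow\<close> and
    from the cofactor; the exponents add up to \<open>2 * d - q\<close>.\<close>
  have sgn: "(-1) ^ d * (-1) ^ m * (-1) ^ (d - q - m) = (-1::complex) ^ q" if "m \<le> d - q" for m
  proof -
    have "d + m + (d - q - m) + q = 2 * d"
      using that q by auto
    hence "even (d + m + (d - q - m)) \<longleftrightarrow> even q"
      by (metis dvd_triv_left even_add)
    hence "(-1::complex) ^ (d + m + (d - q - m)) = (-1) ^ q"
      by (simp only: minus_one_power_iff)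
    thus ?thesis
      by (simp only: power_add)
  qed
  have "(-1) ^ d * (\<Sum>m\<le>d - q. fps_nth bern m * (-1) ^ m *
      subset_sum_op d (\<lambda>x. (a m - L (of_nat M * x) / cofactor q m ?q) * (of_nat M * x) ^ (d - q - m)) w) =
    (\<Sum>m\<le>d - q. (if m = d - q then fps_nth bern m * (-1) ^ m * H else 0) -
       (-1) ^ q / fact (q - 1) * (fps_nth bern m / fact (d - q - m) * F (d - q - m) * of_nat M ^ (d - q - m)))"
    unfolding sum_distrib_left
  proof (intro sum.cong refl)
    fix m assume "m \<in> {..d - q}"
    hence m: "m \<le> d - q"
      by simp
    let ?k = "d - q - m"
    have "1 / cofactor q m ?q = (-1) ^ ?k / (fact (q - 1) * fact ?k)"
      by (simp add: cofactor_at[OF q m] field_simps flip: power_mult_distrib)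
    hence 1: "(-1) ^ d * (fps_nth bern m * (-1) ^ m * (of_nat M ^ ?k * F ?k / cofactor q m ?q)) =
            ((-1) ^ d * (-1) ^ m * (-1) ^ ?k) / fact (q - 1) *
              (fps_nth bern m / fact ?k * F ?k * of_nat M ^ ?k)"
      by (simp add: divide_inverse mult_ac)
    have 2: "(-1) ^ d * (fps_nth bern m * (-1) ^ m *
            (if m = d - q then (-1) ^ d * (of_real (ln (real M)) / cofactor q m ?q - a m) else 0)) =
          (if m = d - q then fps_nth bern m * (-1) ^ m * H else 0)"
    proof (cases "m = d - q")
      case True
      hence "of_real (ln (real M)) / cofactor q m ?q - a m = H"
        using deriv_inverse_cofactor[OF q] cofactor_at[OF q m]
        by (simp add: a_def H_def add_divide_distrib)
      thus ?thesis
        using True by (simp add: algebra_simps flip: power_mult_distrib)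
    qed auto
    show "(-1) ^ d * (fps_nth bern m * (-1) ^ m *
        subset_sum_op d (\<lambda>x. (a m - L (of_nat M * x) / cofactor q m ?q) * (of_nat M * x) ^ ?k) w) =
      (if m = d - q then fps_nth bern m * (-1) ^ m * H else 0) -
       (-1) ^ q / fact (q - 1) * (fps_nth bern m / fact ?k * F ?k * of_nat M ^ ?k)"
    proof -
      have "(-1) ^ d * (fps_nth bern m * (-1) ^ m * (A - B)) =
              (-1) ^ d * (fps_nth bern m * (-1) ^ m * A) - (-1) ^ d * (fps_nth bern m * (-1) ^ m * B)"
        for A B
        by (simp add: right_diff_distrib)
      moreover have "subset_sum_op d (\<lambda>x. x ^ ?k * L x) w = F ?k"
        by (simp add: F_def)
      ultimately show ?thesis
        by (simp only: scaled_subset_sum[OF q m M] 1 2 sgn[OF m])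
    qed
  qed
  also have "\<dots> = fps_nth bern (d - q) * (-1) ^ (d - q) * H -
      (-1) ^ q / fact (q - 1) * (\<Sum>m\<le>d - q. fps_nth bern m / fact (d - q - m) * F (d - q - m) *
         of_nat M ^ (d - q - m))"
    by (simp add: sum_subtractf sum_distrib_left)
  finally have "deriv (\<lambda>\<alpha>. corrected_sum (d - q) M \<alpha> / cofactor q 0 \<alpha>) ?q =
     (\<Sum>n\<in>cube d (M - 1) - {zero_tuple d}. branch_power L (tuple_dot d n w) (- ?q)) -
     (fps_nth bern (d - q) * (-1) ^ (d - q) * H -
      (-1) ^ q / fact (q - 1) * (\<Sum>m\<le>d - q. fps_nth bern m / fact (d - q - m) * F (d - q - m) *
         of_nat M ^ (d - q - m)))"
    by (simp only: deriv_corrected_sum[OF q M] a_def)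
  moreover have "(-1) ^ (d + q + 1) = - ((-1::complex) ^ (d - q))"
    using q by (auto simp: minus_one_power_iff even_diff_nat)
  ultimately show ?thesis
    by (simp add: bernoullian_deriv_0_eq_bern F_def H_def atLeast0AtMost algebra_simps add_divide_distrib)
qed

end

theorem mainTheorem6:
  fixes \<theta> :: real and L :: "complex \<Rightarrow> complex"
    and d q :: nat and w :: "nat \<Rightarrow> complex"
  assumes "log_branch_on L (half_plane \<theta>)"
    and "d \<ge> 1"
    and "\<And>i. i \<in> {1..d} \<Longrightarrow> w i \<in> half_plane \<theta>"
    and "q \<in> {1..d}"
  shows "\<exists>l. (\<lambda>M::nat.
            (-1) ^ q / fact (q - 1) *
              (\<Sum>m=0..d-q. bernoullian_deriv_0 d w m / (fact m * fact (d - q - m)) *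
                 subset_sum_op d (\<lambda>x. x ^ (d - q - m) * L x) w * of_nat M ^ (d - q - m))
            + bernoullian_deriv_0 d w (d - q) * (-1) ^ (d + q + 1) / (fact (q - 1) * fact (d - q)) *
                of_real (ln (real M))
            + (\<Sum>n\<in>cube d (M - 1) - {zero_tuple d}. branch_power L (tuple_dot d n w) (- of_nat q)))
          \<longlonglongrightarrow> l
        \<and> finite_part (barnes_zeta L d w) (of_nat q) =
            l + bernoullian_deriv_0 d w (d - q) * (-1) ^ (d + q + 1) / (fact (q - 1) * fact (d - q)) *
                  harm (q - 1)"
    (is "\<exists>l. ?T \<longlonglongrightarrow> l \<and> ?FP = l + ?C")
proof -
  interpret barnes_setting \<theta> L d w
    by unfold_locales (use assms in auto)
  have "\<forall>\<^sub>F M in sequentially.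
          deriv (\<lambda>\<alpha>. corrected_sum (d - q) M \<alpha> / cofactor q 0 \<alpha>) (of_nat q) = ?T M + ?C"
    using eventually_ge_at_top[of "1::nat"]
    by eventually_elim (rule deriv_corrected_sum_explicit[OF assms(4)])
  hence "(\<lambda>M. ?T M + ?C) \<longlonglongrightarrow> ?FP"
    using deriv_corrected_sum_tendsto[OF assms(4)] by (rule Lim_transform_eventually[rotated])
  \<comment> \<open>The harmonic term does not depend on \<open>M\<close>, so subtracting it gives
    the existence of the limit along with its value.\<close>
  from tendsto_diff[OF this tendsto_const[of ?C]] have "?T \<longlonglongrightarrow> ?FP - ?C"
    by simp
  thus ?thesis
    by (intro exI[of _ "?FP - ?C"]) simp
qed

end
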